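(* Let $\bar A=(A_0,A_1)$ be a compatible couple of (quasi-)Banach spaces with $A_0\cap A_1\neq\{0\}$. Let $0<q_1,r_1\le\infty$ and $a_1,b_1\in SV$ be such that $\|s^{-1/r_1}b_1(s)\|_{r_1,(1,\infty)}<\infty$ and $\left\|s^{-1/r_1}b_1(s)\|u^{-1/q_1}a_1(u)\|_{q_1,(0,s)}\right\|_{r_1,(0,1)}<\infty$, and put $$\chi_1(t)=\left\|s^{-1/r_1}b_1(s)\|u^{-1/q_1}a_1(u)\|_{q_1,(0,s)}\right\|_{r_1,(0,t)}+\|s^{-1/r_1}b_1(s)\|_{r_1,(t,\infty)}\|u^{-1/q_1}a_1(u)\|_{q_1,(0,t)}.$$ Let $0<r_0,q_0\le\infty$, $a_0,b_0\in SV$, $\|s^{-1/r_0}b_0(s)\|_{r_0,(0,1)}<\infty$, and $\left\|s^{-1/r_0}b_0(s)\|u^{-1/q_0}a_0(u)\|_{q_0,(s,\infty)}\right\|_{r_0,(1,\infty)}<\infty$. Put $$\chi_0(t)=\left\|s^{-1/r_0}b_0(s)\|u^{-1/q_0}a_0(u)\|_{q_0,(s,\infty)}\right\|_{r_0,(t,\infty)}+\|s^{-1/r_0}b_0(s)\|_{r_0,(0,t)}\|u^{-1/q_0}a_0(u)\|_{q_0,(t,\infty)}$$ and $\rho(t)=t\frac{\chi_0(t)}{\chi_1(t)}$. Then, for all $f\in\bar A^{\mathcal R}_{0,r_0,b_0,q_0,a_0}+\bar A^{\mathcal L}_{1,r_1,b_1,q_1,a_1}$ and $t>0$, $$\begin{aligned}K\left(\rho(t),f;\bar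 A^{\mathcal R}_{0,r_0,b_0,q_0,a_0},\bar A^{\mathcal L}_{1,r_1,b_1,q_1,a_1}\right)\approx{}&\left\|s^{-1/r_0}b_0(s)\|u^{-1/q_0}a_0(u)K(u,f)\|_{q_0,(s,t)}\right\|_{r_0,(0,t)}\\&+\rho(t)\left\|s^{-1/r_1}b_1(s)\|u^{-1-1/q_1}a_1(u)K(u,f)\|_{q_1,(t,s)}\right\|_{r_1,(t,\infty)}+\chi_0(t)K(t,f),\end{aligned}$$ with equivalence constants independent of $f$ and $t$.
   Context: Conventions: $1/\infty=0$; $\|\cdot\|_{q,(a,b)}$ is the usual (quasi-)norm of $L_q$ on the interval $(a,b)$, $0<q\le\infty$. $F\approx G$ means $C^{-1}G\le F\le CG$ for some constant $C>0$ independent of all significant quantities. $b\in SV$ (slowly varying) means that $b$ is a positive Lebesgue measurable function on $(0,\infty)$ such that for each $\varepsilon>0$ the function $t^{\varepsilon}b(t)$ is equivalent ($\approx$) to an increasing function and $t^{-\varepsilon}b(t)$ is equivalent to a decreasing function. For a compatible couple $(X_0,X_1)$ of (quasi-)normed spaces, $K(t,f;X_0,X_1)=\inf\{\|f_0\|_{X_0}+t\|f_1\|_{X_1}: f=f_0+f_1,\ f_i\in X_i\}$ for $f\in X_0+X_1$, $t>0$; $K(t,f):=K(t,f;A_0,A_1)$. For $0\le\theta\le1$, $0<r,q\le\infty$, $a,b\in SV$, the following are the spaces of all $f\in A_0+A_1$ with finite (quasi-)norm: $\bar A^{\mathcal L}_{\theta,r,b,q,a}$: $\left\|t^{-1/r}b(t)\|u^{-\theta-1/q}a(u)K(u,f)\|_{q,(0,t)}\right\|_{r,(0,\infty)}$;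 $\bar A^{\mathcal R}_{\theta,r,b,q,a}$: $\left\|t^{-1/r}b(t)\|u^{-\theta-1/q}a(u)K(u,f)\|_{q,(t,\infty)}\right\|_{r,(0,\infty)}$. Standing assumption: none of the spaces under consideration is $\{0\}$. *)

theory Defs
  imports "HOL-Analysis.Analysis" "HOL-Probability.Essential_Supremum"
begin

(* Only used with exponents p > 0. *)
definition enn_powr :: "ennreal \<Rightarrow> real \<Rightarrow> ennreal" where
  "enn_powr x p = (if x = \<infinity> then \<infinity> else ennreal (enn2real x powr p))"

(* The exponent 1/q with 1/\<infinity> = 0. *)
definition recip :: "ennreal \<Rightarrow> real" where
  "recip q = enn2real (inverse q)"

(* The functions are non-negative and may take the value \<infinity>, since the inner norm of a
   nested norm may be infinite. *)
definition Lq_norm :: "ennreal \<Rightarrow> real set \<Rightarrow> (real \<Rightarrow> ennreal) \<Rightarrow> ennreal" where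
  "Lq_norm q I h =
     (if q = \<infinity> then esssup (lebesgue_on I) h
      else enn_powr (\<integral>\<^sup>+ u. enn_powr (h u) (enn2real q) \<partial>lebesgue_on I) (recip q))"

(* \<parallel>u^(-\<theta>-1/q) a(u) h(u)\<parallel>_{q,I} *)
definition wnorm :: "real \<Rightarrow> ennreal \<Rightarrow> (real \<Rightarrow> real) \<Rightarrow> real set \<Rightarrow> (real \<Rightarrow> ennreal) \<Rightarrow> ennreal" where
  "wnorm \<theta> q a I h = Lq_norm q I (\<lambda>u. ennreal (u powr (- \<theta> - recip q) * a u) * h u)"

definition slowly_varying :: "(real \<Rightarrow> real) \<Rightarrow> bool" where
  "slowly_varying b \<longleftrightarrow>
     b \<in> borel_measurable (lebesgue_on {0<..}) \<and>
     (\<forall>t>0. b t > 0) \<and>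
     (\<forall>\<epsilon>>0.
        (\<exists>g C. C > 0 \<and> mono_on {0<..} g \<and>
           (\<forall>t>0. inverse C * g t \<le> t powr \<epsilon> * b t \<and> t powr \<epsilon> * b t \<le> C * g t)) \<and>
        (\<exists>g C. C > 0 \<and> antimono_on {0<..} g \<and>
           (\<forall>t>0. inverse C * g t \<le> t powr (- \<epsilon>) * b t \<and> t powr (- \<epsilon>) * b t \<le> C * g t)))"

(* A quasi-normed space inside an ambient vector space; only the values of
   qnorm on pts are meaningful. *)
record 'v qspace =
  pts :: "'v set"
  qnorm :: "'v \<Rightarrow> ennreal"

definition quasi_normed :: "('v::real_vector) qspace \<Rightarrow> bool" where
  "quasi_normed X \<longleftrightarrow>
     subspace (pts X) \<and>
     (\<forall>x\<in>pts X. qnorm X x < \<infinity>) \<and>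
     (\<forall>x\<in>pts X. qnorm X x = 0 \<longleftrightarrow> x = 0) \<and>
     (\<forall>c. \<forall>x\<in>pts X. qnorm X (c *\<^sub>R x) = ennreal \<bar>c\<bar> * qnorm X x) \<and>
     (\<exists>C::real. C \<ge> 1 \<and>
        (\<forall>x\<in>pts X. \<forall>y\<in>pts X. qnorm X (x + y) \<le> ennreal C * (qnorm X x + qnorm X y)))"

definition quasi_Banach :: "('v::real_vector) qspace \<Rightarrow> bool" where
  "quasi_Banach X \<longleftrightarrow>
     quasi_normed X \<and>
     (\<forall>x :: nat \<Rightarrow> 'v.
        (\<forall>n. x n \<in> pts X) \<and>
        (\<forall>e>0. \<exists>N. \<forall>m\<ge>N. \<forall>n\<ge>N. qnorm X (x m - x n) < e) \<longrightarrow>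
        (\<exists>l\<in>pts X. (\<lambda>n. qnorm X (x n - l)) \<longlonglongrightarrow> 0))"

definition Hausdorff_tvs :: "('v::real_vector) topology \<Rightarrow> bool" where
  "Hausdorff_tvs T \<longleftrightarrow>
     topspace T = UNIV \<and> Hausdorff_space T \<and>
     continuous_map (prod_topology T T) T (\<lambda>(x, y). x + y) \<and>
     continuous_map (prod_topology euclideanreal T) T (\<lambda>(c, x). c *\<^sub>R x)"

(* By linearity, continuity of the inclusion at 0 suffices. *)
definition continuously_embedded :: "('v::real_vector) qspace \<Rightarrow> 'v topology \<Rightarrow> bool" where
  "continuously_embedded X T \<longleftrightarrow>
     (\<forall>U. openin T U \<and> 0 \<in> U \<longrightarrow> (\<exists>e>0. \<forall>x\<in>pts X. qnorm X x < e \<longrightarrow> x \<in> U))"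

definition compatible_couple :: "('v::real_vector) qspace \<Rightarrow> 'v qspace \<Rightarrow> bool" where
  "compatible_couple A0 A1 \<longleftrightarrow>
     quasi_Banach A0 \<and> quasi_Banach A1 \<and>
     (\<exists>T. Hausdorff_tvs T \<and> continuously_embedded A0 T \<and> continuously_embedded A1 T)"

definition sum_pts :: "('v::real_vector) qspace \<Rightarrow> 'v qspace \<Rightarrow> 'v set" where
  "sum_pts X0 X1 = {f0 + f1 | f0 f1. f0 \<in> pts X0 \<and> f1 \<in> pts X1}"

definition K_fun :: "ennreal \<Rightarrow> 'v \<Rightarrow> ('v::real_vector) qspace \<Rightarrow> 'v qspace \<Rightarrow> ennreal" where
  "K_fun t f X0 X1 =
     Inf {qnorm X0 f0 + t * qnorm X1 f1 | f0 f1. f0 \<in> pts X0 \<and> f1 \<in> pts X1 \<and> f = f0 + f1}"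

definition L_norm :: "real \<Rightarrow> ennreal \<Rightarrow> (real \<Rightarrow> real) \<Rightarrow> ennreal \<Rightarrow> (real \<Rightarrow> real) \<Rightarrow>
    ('v::real_vector) qspace \<Rightarrow> 'v qspace \<Rightarrow> 'v \<Rightarrow> ennreal" where
  "L_norm \<theta> r b q a A0 A1 f =
     wnorm 0 r b {0<..} (\<lambda>t. wnorm \<theta> q a {0<..<t} (\<lambda>u. K_fun (ennreal u) f A0 A1))"

definition R_norm :: "real \<Rightarrow> ennreal \<Rightarrow> (real \<Rightarrow> real) \<Rightarrow> ennreal \<Rightarrow> (real \<Rightarrow> real) \<Rightarrow>
    ('v::real_vector) qspace \<Rightarrow> 'v qspace \<Rightarrow> 'v \<Rightarrow> ennreal" where
  "R_norm \<theta> r b q a A0 A1 f =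
     wnorm 0 r b {0<..} (\<lambda>t. wnorm \<theta> q a {t<..} (\<lambda>u. K_fun (ennreal u) f A0 A1))"

definition L_space :: "real \<Rightarrow> ennreal \<Rightarrow> (real \<Rightarrow> real) \<Rightarrow> ennreal \<Rightarrow> (real \<Rightarrow> real) \<Rightarrow>
    ('v::real_vector) qspace \<Rightarrow> 'v qspace \<Rightarrow> 'v qspace" where
  "L_space \<theta> r b q a A0 A1 =
     \<lparr>pts = {f \<in> sum_pts A0 A1. L_norm \<theta> r b q a A0 A1 f < \<infinity>},
      qnorm = L_norm \<theta> r b q a A0 A1\<rparr>"

definition R_space :: "real \<Rightarrow> ennreal \<Rightarrow> (real \<Rightarrow> real) \<Rightarrow> ennreal \<Rightarrow> (real \<Rightarrow> real) \<Rightarrow>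
    ('v::real_vector) qspace \<Rightarrow> 'v qspace \<Rightarrow> 'v qspace" where
  "R_space \<theta> r b q a A0 A1 =
     \<lparr>pts = {f \<in> sum_pts A0 A1. R_norm \<theta> r b q a A0 A1 f < \<infinity>},
      qnorm = R_norm \<theta> r b q a A0 A1\<rparr>"

end

theory Submission
  imports Defs
begin

text \<open>This is a Holmstedt formula for a pair of limiting spaces. Both spaces have norms of the same
shape once two changes are made: for the right-hand space the positive half-line carries its usual
order and \<open>f\<close> is represented by the increasing function \<open>u \<mapsto> K(u, f)\<close>; for the left-hand space
the order is reversed and \<open>f\<close> is represented by \<open>u \<mapsto> K(u, f) / u\<close>, which increases for the reversed
order. A sign \<open>\<sigma>\<close> records the order, \<open>after \<sigma> t\<close> is the part of the half-line beyond \<open>t\<close>, and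
all estimates on weights are proved once, in the locale \<open>iterated_weights\<close>, for both signs.

There the norm of a function \<open>k\<close> is
\<open>total k = \<parallel>s \<mapsto> \<parallel>k\<parallel>\<^bsub>after s\<^esub>\<parallel>\<close>, its \<open>core\<close> at \<open>t\<close> is what remains when everything beyond \<open>t\<close> is cut off,
and \<open>chi t\<close> is comparable to the part of the norm of the constant function \<open>1\<close> that sees the
region beyond \<open>t\<close>. Four facts carry the proof. An increasing \<open>k\<close> satisfies
\<open>chi t * k t \<le> 2 * total k\<close> (\<open>chi_mult_le_total\<close>). If \<open>k\<close> is bounded by \<open>\<kappa>\<close> everywhere and by \<open>k'\<close>
before \<open>t\<close>, then \<open>total k\<close> is at most a multiple of \<open>core t k' + \<kappa> * chi t\<close> (\<open>total_le_core\<close>). The function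
\<open>chi\<close> decays slower than any power, of which the exponent \<open>1/2\<close> is enough (\<open>chi_growth\<close>). Finally the
core of \<open>u \<mapsto> (u / t) powr (\<sigma> / 2)\<close> is at most a multiple of \<open>chi t\<close> (\<open>core_le_chi\<close>), because such a power
concentrates the inner norm near \<open>t\<close>, where slow variation makes the weight almost constant.

For the upper estimate of the K-functional of the two limiting spaces, split \<open>f = f0 + f1\<close> almost
optimally for \<open>K(t, f)\<close>. Then \<open>K(u, f0)\<close> is bounded by \<open>2 * K(t, f)\<close> everywhere and by a multiple of
\<open>K(u, f)\<close> for \<open>u \<le> t\<close>, with the mirror-image statement for \<open>K(u, f1) / u\<close>, and
\<open>total_le_core\<close> applies to each piece. For the lower estimate, take any splitting \<open>f = g + h\<close> into the
two limiting spaces. The contributions of \<open>g\<close> to the first term and of \<open>h\<close> to the second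
are parts of their norms. The crossed contributions are controlled by a pointwise bound:
\<open>chi_mult_le_total\<close> bounds \<open>K(u, h) / u\<close> by the norm of \<open>h\<close> divided by \<open>\<chi>\<^sub>1(u)\<close>, slow decay of
\<open>\<chi>\<^sub>1\<close> turns this into a power of \<open>u / t\<close>, and \<open>core_le_chi\<close> integrates that power. The
definition of \<open>\<rho>\<close> is exactly what makes the constants of the two crossed estimates match.\<close>

section \<open>Quasi-norms of Lebesgue spaces\<close>

lemma enn_powr_mono: "0 < p \<Longrightarrow> x \<le> y \<Longrightarrow> enn_powr x p \<le> enn_powr y p"
  by (cases x; cases y) (auto simp: enn_powr_def top_unique intro!: ennreal_leI powr_mono2)

lemma enn_powr_mult: "0 < p \<Longrightarrow> enn_powr (x * y) p = enn_powr x p * enn_powr y p"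
  by (cases x; cases y)
     (auto simp: enn_powr_def powr_mult ennreal_mult ennreal_top_mult ennreal_mult_top
       enn2real_mult simp flip: ennreal_mult split: if_splits)

lemma enn_powr_ennreal: "0 \<le> x \<Longrightarrow> enn_powr (ennreal x) p = ennreal (x powr p)"
  by (simp add: enn_powr_def)

lemma enn_powr_inverse: "0 < p \<Longrightarrow> enn_powr (enn_powr x p) (1 / p) = x"
  by (cases x) (auto simp: enn_powr_def powr_powr)

text \<open>The bound \<open>x + y \<le> 2 * max x y\<close> treats concave and convex powers alike, so the same lemma serves
for the exponent \<open>q\<close> inside the integral and for \<open>1/q\<close> outside it.\<close>

lemma enn_powr_add_le:
  assumes "0 < p"
  shows "enn_powr (x + y) p \<le> ennreal (2 powr p) * (enn_powr x p + enn_powr y p)"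
proof -
  have "enn_powr (x + y) p \<le> enn_powr (2 * max x y) p"
    using assms by (intro enn_powr_mono) (auto simp: mult_2 intro: add_mono)
  also have "\<dots> = ennreal (2 powr p) * enn_powr (max x y) p"
    using enn_powr_ennreal[of 2 p] assms by (simp add: enn_powr_mult)
  also have "\<dots> \<le> ennreal (2 powr p) * (enn_powr x p + enn_powr y p)"
    by (intro mult_left_mono) (auto simp: max_def add_increasing add_increasing2)
  finally show ?thesis .
qed

lemma measurable_enn_powr [measurable]:
  assumes [measurable]: "h \<in> borel_measurable M"
  shows "(\<lambda>u. enn_powr (h u) p) \<in> borel_measurable M"
  unfolding enn_powr_def by measurable

lemma recip_infinity [simp]: "recip top = 0"
  by (simp add: recip_def)

lemma recip_finite:
  assumes "0 < q" "q \<noteq> top"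
  shows "recip q = 1 / enn2real q" and "0 < enn2real q" and "0 < recip q"
proof -
  obtain p where p: "q = ennreal p" "0 \<le> p" using assms by (cases q) auto
  then have "0 < p" using assms by auto
  then show "recip q = 1 / enn2real q" "0 < enn2real q" "0 < recip q"
    using p by (simp_all add: recip_def inverse_ennreal inverse_eq_divide)
qed

lemma Lq_norm_finite:
  assumes "0 < q" "q \<noteq> top"
  shows "Lq_norm q I h =
    enn_powr (\<integral>\<^sup>+ u. enn_powr (h u) (enn2real q) \<partial>lebesgue_on I) (1 / enn2real q)"
  using assms by (simp add: Lq_norm_def recip_finite)

lemma Lq_norm_infinite: "Lq_norm top I h = esssup (lebesgue_on I) h"
  by (simp add: Lq_norm_def)

lemma Lq_norm_AE_mono:
  assumes q: "0 < q" and h: "h \<in> borel_measurable (lebesgue_on I)"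
    and le: "AE u in lebesgue_on I. h u \<le> h' u"
  shows "Lq_norm q I h \<le> Lq_norm q I h'"
proof (cases "q = top")
  case True
  then show ?thesis using h le by (simp add: Lq_norm_infinite esssup_AE_mono)
next
  case False
  have "AE u in lebesgue_on I. enn_powr (h u) (enn2real q) \<le> enn_powr (h' u) (enn2real q)"
    using le by eventually_elim (use q False in \<open>simp add: enn_powr_mono recip_finite\<close>)
  then show ?thesis
    using q False by (simp add: Lq_norm_finite recip_finite enn_powr_mono nn_integral_mono_AE)
qed

lemma Lq_norm_mono:
  assumes "0 < q" "I \<in> sets lebesgue" "h \<in> borel_measurable (lebesgue_on I)"
    and "\<And>u. u \<in> I \<Longrightarrow> h u \<le> h' u"
  shows "Lq_norm q I h \<le> Lq_norm q I h'"
  using assms by (intro Lq_norm_AE_mono) (auto intro!: AE_I2)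

lemma Lq_norm_cong:
  assumes "I \<in> sets lebesgue" "\<And>u. u \<in> I \<Longrightarrow> h u = h' u"
  shows "Lq_norm q I h = Lq_norm q I h'"
proof -
  have *: "h \<in> borel_measurable (lebesgue_on I) \<longleftrightarrow> h' \<in> borel_measurable (lebesgue_on I)"
    using assms by (intro measurable_cong) auto
  have "esssup (lebesgue_on I) h = esssup (lebesgue_on I) h'"
  proof (cases "h \<in> borel_measurable (lebesgue_on I)")
    case True
    with * assms show ?thesis by (intro esssup_AE_cong) (auto intro!: AE_I2)
  next
    case False
    with * show ?thesis by (simp add: esssup_non_measurable)
  qed
  moreover have "(\<integral>\<^sup>+ u. enn_powr (h u) (enn2real q) \<partial>lebesgue_on I)
      = (\<integral>\<^sup>+ u. enn_powr (h' u) (enn2real q) \<partial>lebesgue_on I)"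
    using assms by (intro nn_integral_cong) auto
  ultimately show ?thesis by (simp add: Lq_norm_def)
qed

lemma Lq_norm_cmult:
  assumes q: "0 < q" and I: "I \<in> sets lebesgue"
    and h: "h \<in> borel_measurable (lebesgue_on I)" and c: "c < top"
  shows "Lq_norm q I (\<lambda>u. c * h u) = c * Lq_norm q I h"
proof (cases "q = top")
  case True
  have le: "esssup (lebesgue_on I) (\<lambda>u. d * g u) \<le> d * esssup (lebesgue_on I) g"
    if g: "g \<in> borel_measurable (lebesgue_on I)" for d :: ennreal and g
  proof (rule esssup_I)
    show "AE u in lebesgue_on I. d * g u \<le> d * esssup (lebesgue_on I) g"
      using esssup_AE[of g "lebesgue_on I"] by eventually_elim (simp add: mult_left_mono)
  qed (use g in measurable)
  show ?thesis
  proof (cases "c = 0")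
    case True
    then show ?thesis using \<open>q = top\<close> le[OF h, of 0] by (simp add: Lq_norm_infinite)
  next
    case False
    have *: "inverse c * c = 1" using c False by (metis ennreal_inverse_mult less_top not_gr_zero
          mult.commute ennreal_divide_self divide_ennreal_def)
    \<comment> \<open>The inequality \<open>le\<close> for the factor \<open>inverse c\<close> gives the missing direction.\<close>
    have "c * esssup (lebesgue_on I) h = c * esssup (lebesgue_on I) (\<lambda>u. inverse c * (c * h u))"
      by (simp add: * flip: mult.assoc)
    also have "\<dots> \<le> c * (inverse c * esssup (lebesgue_on I) (\<lambda>u. c * h u))"
      using h by (intro mult_left_mono le) auto
    also have "\<dots> = esssup (lebesgue_on I) (\<lambda>u. c * h u)"
      using * by (simp add: mult.commute[of c] flip: mult.assoc)
    finally show ?thesis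
      using \<open>q = top\<close> le[OF h, of c] by (simp add: Lq_norm_infinite antisym)
  qed
next
  case False
  with q have p: "0 < enn2real q" by (simp add: recip_finite)
  have "(\<integral>\<^sup>+ u. enn_powr (c * h u) (enn2real q) \<partial>lebesgue_on I)
      = enn_powr c (enn2real q) * (\<integral>\<^sup>+ u. enn_powr (h u) (enn2real q) \<partial>lebesgue_on I)"
    using h p by (simp add: enn_powr_mult nn_integral_cmult)
  then show ?thesis
    using q False p by (simp add: Lq_norm_finite enn_powr_mult enn_powr_inverse)
qed

lemma Lq_norm_add:
  assumes q: "0 < q"
  obtains C where "0 < C" "C < top"
    "\<And>I g h. \<lbrakk>g \<in> borel_measurable (lebesgue_on I); h \<in> borel_measurable (lebesgue_on I)\<rbrakk>
       \<Longrightarrow> Lq_norm q I (\<lambda>u. g u + h u) \<le> C * (Lq_norm q I g + Lq_norm q I h)"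
proof (cases "q = top")
  case True
  have "Lq_norm q I (\<lambda>u. g u + h u) \<le> 1 * (Lq_norm q I g + Lq_norm q I h)"
    if [measurable]: "g \<in> borel_measurable (lebesgue_on I)" "h \<in> borel_measurable (lebesgue_on I)"
    for I g h
  proof -
    have "AE u in lebesgue_on I. g u + h u \<le> esssup (lebesgue_on I) g + esssup (lebesgue_on I) h"
      using esssup_AE[of g "lebesgue_on I"] esssup_AE[of h "lebesgue_on I"]
      by eventually_elim (rule add_mono)
    then show ?thesis
      using True by (auto simp: Lq_norm_infinite intro!: esssup_I)
  qed
  with that[of 1] show thesis by simp
next
  case False
  define p where "p = enn2real q"
  have p: "0 < p" using q False by (simp add: p_def recip_finite)
  define c where "c = ennreal (2 powr p)"
  define C where "C = enn_powr c (1 / p) * ennreal (2 powr (1 / p))"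
  have "Lq_norm q I (\<lambda>u. g u + h u) \<le> C * (Lq_norm q I g + Lq_norm q I h)"
    if [measurable]: "g \<in> borel_measurable (lebesgue_on I)" "h \<in> borel_measurable (lebesgue_on I)"
    for I g h
  proof -
    let ?i = "\<lambda>g. \<integral>\<^sup>+ u. enn_powr (g u) p \<partial>lebesgue_on I"
    have "?i (\<lambda>u. g u + h u) \<le> (\<integral>\<^sup>+ u. c * (enn_powr (g u) p + enn_powr (h u) p) \<partial>lebesgue_on I)"
      unfolding c_def using p by (intro nn_integral_mono enn_powr_add_le)
    also have "\<dots> = c * (?i g + ?i h)"
      by (simp add: nn_integral_cmult nn_integral_add)
    finally have "Lq_norm q I (\<lambda>u. g u + h u) \<le> enn_powr (c * (?i g + ?i h)) (1 / p)"
      using q False p by (simp add: Lq_norm_finite enn_powr_mono flip: p_def)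
    also have "\<dots> = enn_powr c (1 / p) * enn_powr (?i g + ?i h) (1 / p)"
      using p by (simp add: enn_powr_mult)
    also have "\<dots> \<le> enn_powr c (1 / p) *
        (ennreal (2 powr (1 / p)) * (enn_powr (?i g) (1 / p) + enn_powr (?i h) (1 / p)))"
      using p by (intro mult_left_mono enn_powr_add_le) auto
    also have "\<dots> = C * (Lq_norm q I g + Lq_norm q I h)"
      using q False p by (simp add: Lq_norm_finite C_def mult.assoc flip: p_def)
    finally show ?thesis .
  qed
  moreover have "0 < C" "C < top"
    using p by (simp_all add: C_def c_def enn_powr_ennreal ennreal_mult_less_top flip: ennreal_mult)
  ultimately show thesis using that by blast
qed

text \<open>Norms over different sets become norms over one measure space, where they can be compared. For \<open>q = \<infinity>\<close>
the extension by \<open>0\<close> is harmless because \<open>0\<close> is the least value of \<open>ennreal\<close>.\<close>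

lemma Lq_norm_indicator:
  assumes q: "0 < q" and I: "I \<in> sets lebesgue"
    and h: "h \<in> borel_measurable (lebesgue_on I)"
  shows "Lq_norm q I h = Lq_norm q UNIV (\<lambda>u. h u * indicator I u)"
proof (cases "q = top")
  case True
  have m: "(\<lambda>u. h u * indicator I u) \<in> borel_measurable lebesgue"
    using h I by (simp add: borel_measurable_restrict_space_iff_ennreal)
  have 1: "esssup (lebesgue_on I) h \<le> esssup lebesgue (\<lambda>u. h u * indicator I u)"
  proof (rule esssup_I[OF h])
    have "AE u in lebesgue. h u * indicator I u \<le> esssup lebesgue (\<lambda>u. h u * indicator I u)"
      by (rule esssup_AE)
    then have "AE u in lebesgue. u \<in> I \<longrightarrow> h u \<le> esssup lebesgue (\<lambda>u. h u * indicator I u)"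
      by eventually_elim auto
    then show "AE u in lebesgue_on I. h u \<le> esssup lebesgue (\<lambda>u. h u * indicator I u)"
      using I by (simp add: AE_restrict_space_iff)
  qed
  have "AE u in lebesgue_on I. h u \<le> esssup (lebesgue_on I) h"
    by (rule esssup_AE)
  then have "AE u in lebesgue. u \<in> I \<longrightarrow> h u \<le> esssup (lebesgue_on I) h"
    using I by (simp add: AE_restrict_space_iff)
  then have "AE u in lebesgue. h u * indicator I u \<le> esssup (lebesgue_on I) h"
    by eventually_elim (auto simp: indicator_def)
  then have 2: "esssup lebesgue (\<lambda>u. h u * indicator I u) \<le> esssup (lebesgue_on I) h"
    by (rule esssup_I[OF m])
  show ?thesis using True 1 2 by (simp add: Lq_norm_infinite lebesgue_on_UNIV_eq antisym)
next
  case False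
  have "0 < enn2real q" using q False by (simp add: recip_finite)
  then have "enn_powr (h u * indicator I u) (enn2real q) = enn_powr (h u) (enn2real q) * indicator I u"
    for u by (auto simp: indicator_def enn_powr_def)
  then show ?thesis
    using q False I by (simp add: Lq_norm_finite lebesgue_on_UNIV_eq nn_integral_restrict_space)
qed

text \<open>For \<open>q = \<infinity>\<close> the factor is \<open>l powr 0 = 1\<close>; this is the place where the set must not be a null set.\<close>

lemma Lq_norm_const:
  assumes q: "0 < q" and I: "I \<in> sets lebesgue"
    and m: "emeasure lebesgue I = ennreal l" "0 < l"
  shows "Lq_norm q I (\<lambda>_. c) = c * ennreal (l powr recip q)"
proof -
  have I': "emeasure (lebesgue_on I) (space (lebesgue_on I)) = ennreal l"
    using I m by (simp add: emeasure_restrict_space)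
  show ?thesis
  proof (cases "q = top")
    case True
    have "emeasure (lebesgue_on I) (space (lebesgue_on I)) \<noteq> 0"
      using m unfolding I' by simp
    then show ?thesis using True m by (simp add: Lq_norm_infinite esssup_const)
  next
    case False
    have "(\<integral>\<^sup>+ u. enn_powr c (enn2real q) \<partial>lebesgue_on I) = enn_powr c (enn2real q) * ennreal l"
      unfolding nn_integral_const I' ..
    then show ?thesis
      using q False m by (simp add: Lq_norm_finite recip_finite enn_powr_mult enn_powr_inverse
          enn_powr_ennreal)
  qed
qed

section \<open>Weighted norms\<close>

text \<open>The superlevel sets are upward closed, so their indicators are monotone real functions.\<close>

lemma mono_ennreal_borel_measurable:
  fixes f :: "real \<Rightarrow> ennreal"
  assumes "mono f"
  shows "f \<in> borel_measurable borel"
proof (rule borel_measurableI_greater)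
  fix y
  have "mono (\<lambda>x. indicator {x. y < f x} x :: real)"
    using assms by (auto simp: mono_def indicator_def intro: less_le_trans)
  then have "(\<lambda>x. indicator {x. y < f x} x :: real) \<in> borel_measurable borel"
    by (rule borel_measurable_mono)
  then show "{x \<in> space borel. y < f x} \<in> sets borel"
    by (simp add: borel_measurable_indicator_iff)
qed

text \<open>The functions measured below are K-functionals and inner norms over moving intervals. They are
monotone for one of the two orders of the line, given by the sign \<open>\<sigma>\<close>, and hence measurable.\<close>

lemma oriented_mono_measurable:
  fixes f :: "real \<Rightarrow> ennreal"
  assumes "\<sigma> = 1 \<or> \<sigma> = (-1::real)" "\<And>u v. \<sigma> * u \<le> \<sigma> * v \<Longrightarrow> f u \<le> f v"
  shows "f \<in> borel_measurable lebesgue"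
proof -
  have "(\<lambda>x. f (\<sigma> * x)) \<in> borel_measurable borel"
    by (rule mono_ennreal_borel_measurable, rule monoI, rule assms(2)) (use assms(1) in auto)
  from measurable_compose[OF _ this, of "\<lambda>x. \<sigma> * x" lebesgue]
  have "(\<lambda>x. f (\<sigma> * (\<sigma> * x))) \<in> borel_measurable lebesgue"
    by (simp add: measurable_completion)
  then show ?thesis
    using assms(1) by (auto simp flip: mult.assoc)
qed

lemma oriented_antimono_measurable:
  fixes f :: "real \<Rightarrow> ennreal"
  assumes "\<sigma> = 1 \<or> \<sigma> = (-1::real)" "\<And>u v. \<sigma> * u \<le> \<sigma> * v \<Longrightarrow> f v \<le> f u"
  shows "f \<in> borel_measurable lebesgue"
  using assms by (intro oriented_mono_measurable[of "- \<sigma>"]) auto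

lemma wnorm_cong:
  assumes "I \<in> sets lebesgue" "\<And>u. u \<in> I \<Longrightarrow> h u = h' u"
  shows "wnorm \<theta> q a I h = wnorm \<theta> q a I h'"
  unfolding wnorm_def using assms by (intro Lq_norm_cong) auto

locale weight =
  fixes q :: ennreal and a :: "real \<Rightarrow> real"
  assumes exponent_pos: "0 < q"
    and weight_measurable: "a \<in> borel_measurable (lebesgue_on {0<..})"
begin

abbreviation N :: "real set \<Rightarrow> (real \<Rightarrow> ennreal) \<Rightarrow> ennreal" where
  "N \<equiv> wnorm 0 q a"

lemma weighted_measurable:
  assumes "I \<subseteq> {0<..}" "h \<in> borel_measurable lebesgue"
  shows "(\<lambda>u. ennreal (u powr (- 0 - recip q) * a u) * h u) \<in> borel_measurable (lebesgue_on I)"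
proof -
  have [measurable]: "a \<in> borel_measurable (lebesgue_on I)"
    by (rule measurable_restrict_mono[OF weight_measurable assms(1)])
  have [measurable]: "h \<in> borel_measurable (lebesgue_on I)"
    by (rule measurable_restrict_space1[OF assms(2)])
  have [measurable]: "(\<lambda>u::real. u) \<in> borel_measurable (lebesgue_on I)"
    by (intro measurable_restrict_space1 measurable_completion) auto
  show ?thesis by measurable
qed

lemma N_indicator:
  assumes "I \<in> sets lebesgue" "I \<subseteq> {0<..}" "h \<in> borel_measurable lebesgue"
  shows "N I h = Lq_norm q UNIV
    (\<lambda>u. ennreal (u powr (- 0 - recip q) * a u) * h u * indicator I u)"
    and "(\<lambda>u. ennreal (u powr (- 0 - recip q) * a u) * h u * indicator I u)
      \<in> borel_measurable (lebesgue_on UNIV)"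
  using Lq_norm_indicator[OF exponent_pos assms(1) weighted_measurable[OF assms(2,3)]]
    weighted_measurable[OF assms(2,3)] assms(1)
  by (auto simp: wnorm_def borel_measurable_restrict_space_iff_ennreal lebesgue_on_UNIV_eq)

lemma N_mono:
  assumes "I \<in> sets lebesgue" "J \<in> sets lebesgue" "I \<subseteq> J" "J \<subseteq> {0<..}"
    and "h \<in> borel_measurable lebesgue" "h' \<in> borel_measurable lebesgue"
    and "\<And>u. u \<in> I \<Longrightarrow> h u \<le> h' u"
  shows "N I h \<le> N J h'"
proof -
  have I0: "I \<subseteq> {0<..}" using assms by auto
  have "Lq_norm q UNIV (\<lambda>u. ennreal (u powr (- 0 - recip q) * a u) * h u * indicator I u)
    \<le> Lq_norm q UNIV (\<lambda>u. ennreal (u powr (- 0 - recip q) * a u) * h' u * indicator J u)"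
    by (rule Lq_norm_mono[OF exponent_pos _ N_indicator(2)])
      (use assms I0 in \<open>auto intro: mult_left_mono simp: indicator_def\<close>)
  then show ?thesis
    using assms I0 by (simp only: N_indicator)
qed

lemma N_cmult:
  assumes "I \<in> sets lebesgue" "I \<subseteq> {0<..}" "h \<in> borel_measurable lebesgue" "c < top"
  shows "N I (\<lambda>u. c * h u) = c * N I h"
  using Lq_norm_cmult[OF exponent_pos assms(1) weighted_measurable[OF assms(2,3)] assms(4)]
  by (simp add: wnorm_def mult_ac)

lemma N_const:
  assumes "I \<in> sets lebesgue" "I \<subseteq> {0<..}" "c < top"
  shows "N I (\<lambda>u. c) = c * N I (\<lambda>_. 1)"
  using N_cmult[of I "\<lambda>_. 1" c] assms by simp

lemma N_add:
  obtains C where "0 < C" "C < top"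
    "\<And>I g h. \<lbrakk>I \<subseteq> {0<..}; g \<in> borel_measurable lebesgue; h \<in> borel_measurable lebesgue\<rbrakk>
       \<Longrightarrow> N I (\<lambda>u. g u + h u) \<le> C * (N I g + N I h)"
proof -
  obtain C where C: "0 < C" "C < top"
    "\<And>I g h. \<lbrakk>g \<in> borel_measurable (lebesgue_on I); h \<in> borel_measurable (lebesgue_on I)\<rbrakk>
       \<Longrightarrow> Lq_norm q I (\<lambda>u. g u + h u) \<le> C * (Lq_norm q I g + Lq_norm q I h)"
    using Lq_norm_add[OF exponent_pos] by metis
  show thesis
    by (rule that[OF C(1,2)])
      (auto simp: wnorm_def distrib_left simp del: minus_zero diff_0 intro!: C(3) [unfolded distrib_left] weighted_measurable)
qed

text \<open>Half-lines are open here. The exceptional point, a null set, lets two adjacent open intervals cover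
an interval.\<close>

lemma N_Un:
  obtains C where "0 < C" "C < top"
    "\<And>I J J' t h. \<lbrakk>I \<in> sets lebesgue; J \<in> sets lebesgue; J' \<in> sets lebesgue; I \<subseteq> {0<..};
        J \<subseteq> {0<..}; J' \<subseteq> {0<..}; I \<subseteq> insert t (J \<union> J'); h \<in> borel_measurable lebesgue\<rbrakk>
       \<Longrightarrow> N I h \<le> C * (N J h + N J' h)"
proof -
  obtain C where C: "0 < C" "C < top"
    "\<And>I g h. \<lbrakk>g \<in> borel_measurable (lebesgue_on I); h \<in> borel_measurable (lebesgue_on I)\<rbrakk>
       \<Longrightarrow> Lq_norm q I (\<lambda>u. g u + h u) \<le> C * (Lq_norm q I g + Lq_norm q I h)"
    using Lq_norm_add[OF exponent_pos] by metis
  have "N I h \<le> C * (N J h + N J' h)"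
    if I: "I \<in> sets lebesgue" "J \<in> sets lebesgue" "J' \<in> sets lebesgue" "I \<subseteq> {0<..}"
      "J \<subseteq> {0<..}" "J' \<subseteq> {0<..}" "I \<subseteq> insert t (J \<union> J')" "h \<in> borel_measurable lebesgue"
    for I J J' and t :: real and h
  proof -
    let ?f = "\<lambda>I u. ennreal (u powr (- 0 - recip q) * a u) * h u * indicator I u"
    have "AE u in lebesgue. u \<noteq> t"
      by (rule AE_not_in[of "{t}", simplified]) (simp add: null_sets_completionI)
    then have "AE u in lebesgue_on UNIV. ?f I u \<le> ?f J u + ?f J' u"
      unfolding lebesgue_on_UNIV_eq
      by eventually_elim (use I(7) in \<open>auto simp: indicator_def\<close>)
    then have "Lq_norm q UNIV (?f I) \<le> Lq_norm q UNIV (\<lambda>u. ?f J u + ?f J' u)"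
      using I exponent_pos by (intro Lq_norm_AE_mono N_indicator)
    also have "\<dots> \<le> C * (Lq_norm q UNIV (?f J) + Lq_norm q UNIV (?f J'))"
      using I by (intro C N_indicator)
    finally show ?thesis
      using I by (simp only: N_indicator)
  qed
  with C(1,2) show thesis using that by metis
qed

lemma N_ge:
  assumes I: "I \<in> sets lebesgue" "I \<subseteq> {0<..}" "emeasure lebesgue I = ennreal l" "0 < l"
    and "\<And>u. u \<in> I \<Longrightarrow> m \<le> u powr (- recip q) * a u"
  shows "ennreal m * ennreal (l powr recip q) \<le> N I (\<lambda>_. 1)"
proof -
  have "ennreal m * ennreal (l powr recip q) = Lq_norm q I (\<lambda>_. ennreal m)"
    using Lq_norm_const[OF exponent_pos I(1,3,4)] by simp
  also have "\<dots> \<le> N I (\<lambda>_. 1)"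
    unfolding wnorm_def using assms exponent_pos
    by (intro Lq_norm_mono) (auto intro: ennreal_leI)
  finally show ?thesis .
qed

lemma N_finite:
  assumes I: "I \<in> sets lebesgue" "I \<subseteq> {0<..}" "emeasure lebesgue I = ennreal l" "0 < l"
    and "\<And>u. u \<in> I \<Longrightarrow> u powr (- recip q) * a u \<le> m"
  shows "N I (\<lambda>_. 1) < top"
proof -
  have "N I (\<lambda>_. 1) \<le> Lq_norm q I (\<lambda>_. ennreal m)"
    unfolding wnorm_def using assms exponent_pos
    by (intro Lq_norm_mono weighted_measurable) (auto intro: ennreal_leI)
  also have "\<dots> = ennreal m * ennreal (l powr recip q)"
    using Lq_norm_const[OF exponent_pos I(1,3,4)] by simp
  also have "\<dots> < top"
    by (simp add: ennreal_mult_less_top)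
  finally show ?thesis .
qed

end

section \<open>Slowly varying weights on oriented half-lines\<close>

text \<open>The two one-sided conditions merged into a single comparison of values: in either direction the
weight changes more slowly than every power of the ratio of the arguments.\<close>

lemma slowly_varying_ratio:
  assumes "slowly_varying a" "0 < \<epsilon>"
  obtains c where "0 < c"
    "\<And>u t. \<lbrakk>0 < u; 0 < t\<rbrakk> \<Longrightarrow> a u \<le> c * max (u / t) (t / u) powr \<epsilon> * a t"
proof -
  have pos: "0 < a u" if "0 < u" for u
    using assms(1) that unfolding slowly_varying_def by blast
  obtain g C where C: "0 < C" and g: "mono_on {0<..} g"
    and gC: "\<forall>t>0. inverse C * g t \<le> t powr \<epsilon> * a t \<and> t powr \<epsilon> * a t \<le> C * g t"
    using assms unfolding slowly_varying_def by blast
  obtain g' C' where C': "0 < C'" and g': "antimono_on {0<..} g'"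
    and gC': "\<forall>t>0. inverse C' * g' t \<le> t powr (- \<epsilon>) * a t \<and> t powr (- \<epsilon>) * a t \<le> C' * g' t"
    using assms unfolding slowly_varying_def by blast
  define c where "c = max (C * C) (C' * C')"
  have "a u \<le> c * max (u / t) (t / u) powr \<epsilon> * a t" if "0 < u" "0 < t" for u t
  proof (cases "u \<le> t")
    case True
    have "u powr \<epsilon> * a u \<le> C * g u" using gC that by auto
    also have "\<dots> \<le> C * g t"
      using C g that True by (intro mult_left_mono) (auto simp: monotone_on_def)
    also have "\<dots> \<le> C * (C * (t powr \<epsilon> * a t))"
      using gC \<open>0 < t\<close> C by (intro mult_left_mono) (auto simp: field_simps)
    also have "\<dots> = (C * C) * (t powr \<epsilon> * a t)"
      by (rule mult.assoc[symmetric])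
    also have "\<dots> \<le> c * (t powr \<epsilon> * a t)"
      using pos[OF \<open>0 < t\<close>] by (intro mult_right_mono) (auto simp: c_def less_imp_le)
    finally have "a u \<le> c * (t powr \<epsilon> * a t) / u powr \<epsilon>"
      using that by (simp only: pos_le_divide_eq powr_gt_zero mult.commute[of "a u"])
    moreover have "u / t \<le> 1" "1 \<le> t / u"
      using True that by auto
    then have "max (u / t) (t / u) = t / u" by linarith
    ultimately show ?thesis using that by (simp add: powr_divide mult_ac)
  next
    case False
    have "u powr (- \<epsilon>) * a u \<le> C' * g' u" using gC' that by auto
    also have "\<dots> \<le> C' * g' t"
      using C' g' that False by (intro mult_left_mono) (auto simp: monotone_on_def)
    also have "\<dots> \<le> C' * (C' * (t powr (- \<epsilon>) * a t))"
      using gC' \<open>0 < t\<close> C' by (intro mult_left_mono) (auto simp: field_simps)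
    also have "\<dots> = (C' * C') * (t powr (- \<epsilon>) * a t)"
      by (rule mult.assoc[symmetric])
    also have "\<dots> \<le> c * (t powr (- \<epsilon>) * a t)"
      using pos[OF \<open>0 < t\<close>] by (intro mult_right_mono) (auto simp: c_def less_imp_le)
    finally have "a u \<le> c * (t powr (- \<epsilon>) * a t) / u powr (- \<epsilon>)"
      using that by (simp only: pos_le_divide_eq powr_gt_zero mult.commute[of "a u"])
    moreover have "1 \<le> u / t" "t / u \<le> 1"
      using False that by auto
    then have "max (u / t) (t / u) = u / t" by linarith
    ultimately show ?thesis using that by (simp add: powr_divide powr_minus) (simp add: divide_inverse mult_ac)
  qed
  moreover have "0 < c" using C by (simp add: c_def less_max_iff_disj)
  ultimately show thesis using that by blast
qed

text \<open>The open half-line beyond \<open>t\<close>, for the usual order if \<open>\<sigma> = 1\<close> and for the reversed order if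
\<open>\<sigma> = -1\<close>. The complementary half-line is \<open>after (- \<sigma>) t\<close>.\<close>

definition after :: "real \<Rightarrow> real \<Rightarrow> real set" where
  "after \<sigma> t = {u. 0 < u \<and> \<sigma> * t < \<sigma> * u}"

lemma after_positive [simp]: "after \<sigma> t \<subseteq> {0<..}"
  by (auto simp: after_def)

lemma after_Int_positive [simp]: "after \<sigma> t \<inter> J \<subseteq> {0<..}"
  by (auto simp: after_def)

lemma afterD:
  assumes "u \<in> after \<sigma> t"
  shows "0 < u" "\<sigma> * t \<le> \<sigma> * u"
  using assms by (auto simp: after_def)

lemma after_measurable [simp, measurable]: "after \<sigma> t \<in> sets lebesgue"
proof -
  have "{u \<in> space borel. 0 < u \<and> \<sigma> * t < \<sigma> * u} \<in> sets borel" by measurable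
  then show ?thesis by (simp add: after_def sets_completionI_sets)
qed

lemma after_mono: "\<sigma> * s \<le> \<sigma> * t \<Longrightarrow> after \<sigma> t \<subseteq> after \<sigma> s"
  by (auto simp: after_def)

lemma after_split:
  assumes "\<sigma> = 1 \<or> \<sigma> = (-1::real)"
  shows "after \<sigma> t \<subseteq> insert u (after \<sigma> t \<inter> after (- \<sigma>) u \<union> after \<sigma> u)"
  using assms by (auto simp: after_def)

lemma positive_split:
  assumes "\<sigma> = 1 \<or> \<sigma> = (-1::real)"
  shows "{0<..} \<subseteq> insert u (after (- \<sigma>) u \<union> after \<sigma> u)"
  using assms by (auto simp: after_def)

locale sv_weight =
  fixes \<sigma> :: real and q :: ennreal and a :: "real \<Rightarrow> real"
  assumes orientation: "\<sigma> = 1 \<or> \<sigma> = - 1"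
    and exponent_pos: "0 < q"
    and slowly_varying: "slowly_varying a"
begin

sublocale weight q a
  using exponent_pos slowly_varying by unfold_locales (auto simp: slowly_varying_def)

lemma pos: "0 < t \<Longrightarrow> 0 < a t"
  using slowly_varying by (simp add: slowly_varying_def)

text \<open>Next to \<open>t\<close> lies a dyadic interval beyond \<open>t\<close>. On it \<open>a\<close> is comparable to \<open>a t\<close>, and the norm of
\<open>u powr (- recip q)\<close> over a dyadic interval does not depend on the scale.\<close>

lemma weight_le_N_after:
  obtains c where "0 < c" "c < top" "\<And>t. 0 < t \<Longrightarrow> ennreal (a t) \<le> c * N (after \<sigma> t) (\<lambda>_. 1)"
proof -
  obtain c where c: "0 < c"
    "\<And>u t. \<lbrakk>0 < u; 0 < t\<rbrakk> \<Longrightarrow> a u \<le> c * max (u / t) (t / u) powr 1 * a t"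
    by (rule slowly_varying_ratio[OF slowly_varying zero_less_one]) blast
  define d where "d = (4::real) powr recip q * (2 * c)"
  have "ennreal (a t) \<le> ennreal d * N (after \<sigma> t) (\<lambda>_. 1)" if t: "0 < t" for t
  proof -
    \<comment> \<open>The interval from \<open>s\<close> to \<open>2 * s\<close> starts or ends at \<open>t\<close>, on the side prescribed by \<open>\<sigma>\<close>.\<close>
    define s where "s = (if \<sigma> = 1 then t else t / 2)"
    have s: "0 < s" "t \<le> 2 * s" "s \<le> t" "{s<..<2 * s} \<subseteq> after \<sigma> t"
      using t orientation by (auto simp: s_def after_def)
    have m: "(4 * s) powr (- recip q) * (a t / (2 * c)) \<le> u powr (- recip q) * a u"
      if u: "u \<in> {s<..<2 * s}" for u
    proof (rule mult_mono)
      show "(4 * s) powr (- recip q) \<le> u powr (- recip q)"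
        using u s by (intro powr_mono2') (auto simp: recip_def)
      have "a t \<le> c * max (t / u) (u / t) powr 1 * a u"
        using c(2)[of t u] u s t by auto
      also have "max (t / u) (u / t) powr 1 \<le> 2"
        using u s t by (auto simp: divide_simps powr_one max_def)
      then have "c * max (t / u) (u / t) powr 1 * a u \<le> c * 2 * a u"
        using u s c(1) pos[of u] by (intro mult_right_mono mult_left_mono) auto
      finally show "a t / (2 * c) \<le> a u"
        using c(1) by (simp add: field_simps)
    qed (use pos[OF t] c in auto)
    have "ennreal (a t) = ennreal d * (ennreal ((4 * s) powr (- recip q) * (a t / (2 * c))) *
        ennreal (s powr recip q))"
      using c(1) pos[OF t] s(1)
      by (simp add: d_def powr_minus powr_mult field_simps flip: ennreal_mult)
    also have "\<dots> \<le> ennreal d * N {s<..<2 * s} (\<lambda>_. 1)"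
      using s m by (intro mult_left_mono N_ge) auto
    also have "\<dots> \<le> ennreal d * N (after \<sigma> t) (\<lambda>_. 1)"
      using s by (intro mult_left_mono N_mono) auto
    finally show ?thesis .
  qed
  moreover have "0 < d" using c by (simp add: d_def)
  ultimately show thesis using that[of "ennreal d"] by auto
qed

lemma N_after_pos: "0 < t \<Longrightarrow> 0 < N (after \<sigma> t) (\<lambda>_. 1)"
proof (rule ccontr)
  obtain c where c: "\<And>t. 0 < t \<Longrightarrow> ennreal (a t) \<le> c * N (after \<sigma> t) (\<lambda>_. 1)"
    using weight_le_N_after by metis
  assume "0 < t" "\<not> 0 < N (after \<sigma> t) (\<lambda>_. 1)"
  then show False using c[of t] pos[of t] by simp
qed

lemma N_between_finite:
  assumes "0 < s" "0 < t"
  shows "N (after \<sigma> s \<inter> after (- \<sigma>) t) (\<lambda>_. 1) < top"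
proof -
  define l r where "l = min s t" and "r = 2 * max s t"
  have lr: "0 < l" "l < r" using assms by (auto simp: l_def r_def)
  obtain c where c: "0 < c"
    "\<And>u t. \<lbrakk>0 < u; 0 < t\<rbrakk> \<Longrightarrow> a u \<le> c * max (u / t) (t / u) powr 1 * a t"
    by (rule slowly_varying_ratio[OF slowly_varying zero_less_one]) blast
  have "N (after \<sigma> s \<inter> after (- \<sigma>) t) (\<lambda>_. 1) \<le> N {l<..<r} (\<lambda>_. 1)"
    using orientation assms lr by (intro N_mono) (auto simp: after_def l_def r_def)
  also have "\<dots> < top"
  proof (rule N_finite[of _ "r - l" "l powr (- recip q) * (c * (r / l) * a l)"])
    fix u assume u: "u \<in> {l<..<r}"
    show "u powr (- recip q) * a u \<le> l powr (- recip q) * (c * (r / l) * a l)"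
    proof (rule mult_mono)
      show "u powr (- recip q) \<le> l powr (- recip q)"
        using u lr by (intro powr_mono2') (auto simp: recip_def)
      have "a u \<le> c * max (u / l) (l / u) powr 1 * a l"
        using c(2)[of u l] u lr by auto
      also have "\<dots> \<le> c * (r / l) * a l"
        using u lr c(1) pos[of l]
        by (intro mult_right_mono mult_left_mono) (auto simp: divide_simps mult_mono')
      finally show "a u \<le> c * (r / l) * a l" .
    qed (use u lr pos[of u] in auto)
  qed (use lr in auto)
  finally show ?thesis .
qed

end

text \<open>For finite \<open>q\<close> the \<open>q\<close>-th power of the norm is the integral of \<open>(u / t) powr (\<sigma> * \<epsilon> * q) / u\<close> over the
half-line before \<open>t\<close>, which is scale invariant and converges with value \<open>1 / (\<epsilon> * q)\<close>.\<close>

lemma Lq_norm_power: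
  assumes \<sigma>: "\<sigma> = 1 \<or> \<sigma> = (-1::real)" and q: "0 < q" and \<epsilon>: "0 < \<epsilon>"
  obtains c where "c < top" "\<And>t. 0 < t \<Longrightarrow>
    Lq_norm q (after (- \<sigma>) t) (\<lambda>u. ennreal (u powr (- recip q) * (u / t) powr (\<sigma> * \<epsilon>))) \<le> c"
proof -
  have [measurable]: "(\<lambda>u::real. u) \<in> borel_measurable (lebesgue_on I)" for I
    by (intro measurable_restrict_space1 measurable_completion) auto
  show thesis
  proof (cases "q = top")
    case True
    have "Lq_norm q (after (- \<sigma>) t) (\<lambda>u. ennreal (u powr (- recip q) * (u / t) powr (\<sigma> * \<epsilon>))) \<le> 1"
      if t: "0 < t" for t
    proof -
      have le1: "(u / t) powr (\<sigma> * \<epsilon>) \<le> 1" if u: "u \<in> after (- \<sigma>) t" for u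
      proof (cases "\<sigma> = 1")
        case True
        then show ?thesis using u t \<epsilon> by (auto simp: after_def intro!: powr_le1)
      next
        case False
        then have s: "\<sigma> = -1" using \<sigma> by simp
        have "(u / t) powr (\<sigma> * \<epsilon>) = (t / u) powr \<epsilon>"
          using u t by (simp add: s after_def powr_minus powr_divide)
        also have "\<dots> \<le> 1"
          using u t \<epsilon> by (intro powr_le1) (auto simp: s after_def)
        finally show ?thesis .
      qed
      have "esssup (lebesgue_on (after (- \<sigma>) t)) (\<lambda>u. ennreal (u powr (- recip q) * (u / t) powr (\<sigma> * \<epsilon>))) \<le> 1"
      proof (rule esssup_I)
        show "AE u in lebesgue_on (after (- \<sigma>) t). ennreal (u powr (- recip q) * (u / t) powr (\<sigma> * \<epsilon>)) \<le> 1"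
          using le1 True by (intro AE_I2) (auto simp: after_def)
      qed measurable
      then show ?thesis using True by (simp add: Lq_norm_infinite)
    qed
    then show thesis using that[of 1] by simp
  next
    case False
    define p where "p = enn2real q"
    have p: "0 < p" "recip q = 1 / p" using q False by (simp_all add: p_def recip_finite)
    define k where "k = \<epsilon> * p"
    have k: "0 < k" using p \<epsilon> by (simp add: k_def)
    have bound: "(\<integral>\<^sup>+ u. enn_powr (ennreal (u powr (- recip q) * (u / t) powr (\<sigma> * \<epsilon>))) p
        \<partial>lebesgue_on (after (- \<sigma>) t)) \<le> ennreal (1 / k)" if t: "0 < t" for t
    proof -
      define J where "J = (if \<sigma> = 1 then {0..t} else {t..})"
      have I: "after (- \<sigma>) t \<subseteq> J" using \<sigma> by (auto simp: J_def after_def)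
      have integrand: "enn_powr (ennreal (u powr (- recip q) * (u / t) powr (\<sigma> * \<epsilon>))) p
          = ennreal (t powr (- \<sigma> * k)) * ennreal (u powr (\<sigma> * k - 1))" if "0 < u" for u
        using that t p
        by (simp add: enn_powr_ennreal powr_mult powr_powr powr_divide k_def powr_diff powr_minus
            field_simps flip: ennreal_mult)
      have "((\<lambda>u. u powr (\<sigma> * k - 1)) has_integral t powr (\<sigma> * k) / k) J"
      proof (cases "\<sigma> = 1")
        case True
        then show ?thesis
          using has_integral_powr_from_0[of "k - 1" t] k t by (simp add: J_def)
      next
        case False
        then have "\<sigma> = -1" using \<sigma> by simp
        then show ?thesis
          using has_integral_powr_to_inf[of "- k - 1" t] k t by (simp add: J_def)
      qed
      then have J: "(\<integral>\<^sup>+ u. ennreal (u powr (\<sigma> * k - 1)) * indicator J u \<partial>lborel)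
          = ennreal (t powr (\<sigma> * k) / k)"
        by (intro nn_integral_has_integral_lebesgue') auto
      have "(\<integral>\<^sup>+ u. enn_powr (ennreal (u powr (- recip q) * (u / t) powr (\<sigma> * \<epsilon>))) p
          \<partial>lebesgue_on (after (- \<sigma>) t))
        = (\<integral>\<^sup>+ u. enn_powr (ennreal (u powr (- recip q) * (u / t) powr (\<sigma> * \<epsilon>))) p
            * indicator (after (- \<sigma>) t) u \<partial>lborel)"
        by (simp add: nn_integral_restrict_space nn_integral_completion)
      also have "\<dots> \<le> (\<integral>\<^sup>+ u. ennreal (t powr (- \<sigma> * k)) *
          (ennreal (u powr (\<sigma> * k - 1)) * indicator J u) \<partial>lborel)"
        using I integrand by (intro nn_integral_mono) (auto simp: indicator_def after_def)
      also have "\<dots> = ennreal (t powr (- \<sigma> * k)) * ennreal (t powr (\<sigma> * k) / k)"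
        using J by (subst nn_integral_cmult) (auto simp: J_def)
      also have "\<dots> = ennreal (1 / k)"
        using t k by (simp add: powr_minus field_simps flip: ennreal_mult)
      finally show ?thesis .
    qed
    have "Lq_norm q (after (- \<sigma>) t) (\<lambda>u. ennreal (u powr (- recip q) * (u / t) powr (\<sigma> * \<epsilon>)))
        \<le> enn_powr (ennreal (1 / k)) (1 / p)" if "0 < t" for t
      using bound[OF that] q False p(1) by (simp add: Lq_norm_finite enn_powr_mono flip: p_def)
    moreover have "enn_powr (ennreal (1 / k)) (1 / p) < top"
      using k by (simp add: enn_powr_ennreal)
    ultimately show thesis using that by blast
  qed
qed

context sv_weight
begin

lemma oriented_ratio_powr:
  assumes "0 < t" "u \<in> after (- \<sigma>) t"
  shows "max (u / t) (t / u) = (u / t) powr (- \<sigma>)"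
  using assms orientation
  by (auto simp: after_def powr_minus max_def divide_simps) (smt (verit) mult_mono)+

text \<open>One half of the exponent \<open>\<sigma> / 2\<close> absorbs the variation of \<open>a\<close> away from \<open>t\<close>, and the other half makes
the remaining power integrable.\<close>

lemma N_before_power_le:
  obtains c where "c < top" "\<And>t. 0 < t \<Longrightarrow>
    N (after (- \<sigma>) t) (\<lambda>u. ennreal ((u / t) powr (\<sigma> / 2))) \<le> c * ennreal (a t)"
proof -
  obtain c0 where c0: "0 < c0"
    "\<And>u t. \<lbrakk>0 < u; 0 < t\<rbrakk> \<Longrightarrow> a u \<le> c0 * max (u / t) (t / u) powr (1 / 4) * a t"
    using slowly_varying_ratio[OF slowly_varying, of "1 / 4"] by auto
  have "0 < (1 / 4 :: real)" by simp
  from Lq_norm_power[OF orientation exponent_pos this]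
  obtain c1 where c1: "c1 < top" "\<And>t. 0 < t \<Longrightarrow>
    Lq_norm q (after (- \<sigma>) t) (\<lambda>u. ennreal (u powr (- recip q) * (u / t) powr (\<sigma> * (1 / 4)))) \<le> c1"
    by metis
  have [measurable]: "(\<lambda>u::real. u) \<in> borel_measurable (lebesgue_on I)" for I
    by (intro measurable_restrict_space1 measurable_completion) auto
  have "N (after (- \<sigma>) t) (\<lambda>u. ennreal ((u / t) powr (\<sigma> / 2))) \<le> ennreal c0 * c1 * ennreal (a t)"
    if t: "0 < t" for t
  proof -
    let ?J = "after (- \<sigma>) t"
    have pt: "(u / t) powr (\<sigma> / 2) * a u \<le> c0 * a t * (u / t) powr (\<sigma> * (1 / 4))"
      if u: "u \<in> ?J" for u
    proof -
      have u0: "0 < u" using u by (simp add: after_def)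
      have "(u / t) powr (\<sigma> / 2) * a u
          \<le> (u / t) powr (\<sigma> / 2) * (c0 * max (u / t) (t / u) powr (1 / 4) * a t)"
        using u0 t by (intro mult_left_mono c0) auto
      also have "\<dots> = c0 * a t * ((u / t) powr (\<sigma> / 2) * (u / t) powr (- \<sigma> / 4))"
        using t u by (simp add: oriented_ratio_powr powr_powr mult_ac)
      also have "(u / t) powr (\<sigma> / 2) * (u / t) powr (- \<sigma> / 4) = (u / t) powr (\<sigma> * (1 / 4))"
        by (simp flip: powr_add)
      finally show ?thesis .
    qed
    have "N ?J (\<lambda>u. ennreal ((u / t) powr (\<sigma> / 2)))
        \<le> Lq_norm q ?J (\<lambda>u. ennreal (c0 * a t) *
            ennreal (u powr (- recip q) * (u / t) powr (\<sigma> * (1 / 4))))"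
      unfolding wnorm_def
    proof (intro Lq_norm_mono exponent_pos after_measurable weighted_measurable after_positive)
      fix u assume u: "u \<in> ?J"
      have u0: "0 < u" using u by (simp add: after_def)
      have "u powr (- recip q) * ((u / t) powr (\<sigma> / 2) * a u)
          \<le> u powr (- recip q) * (c0 * a t * (u / t) powr (\<sigma> * (1 / 4)))"
        using pt[OF u] by (intro mult_left_mono) auto
      then show "ennreal (u powr (- 0 - recip q) * a u) * ennreal ((u / t) powr (\<sigma> / 2))
          \<le> ennreal (c0 * a t) * ennreal (u powr (- recip q) * (u / t) powr (\<sigma> * (1 / 4)))"
        using pos[OF u0] pos[OF t] c0(1)
        by (simp add: mult_ac flip: ennreal_mult)
    next
      have "(\<lambda>u. ennreal ((u / t) powr (\<sigma> / 2))) \<in> borel_measurable borel" by measurable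
      then show "(\<lambda>u. ennreal ((u / t) powr (\<sigma> / 2))) \<in> borel_measurable lebesgue"
        by (simp add: measurable_completion)
    qed
    also have "\<dots> = ennreal (c0 * a t) *
        Lq_norm q ?J (\<lambda>u. ennreal (u powr (- recip q) * (u / t) powr (\<sigma> * (1 / 4))))"
      by (intro Lq_norm_cmult exponent_pos after_measurable) auto
    also have "\<dots> \<le> ennreal (c0 * a t) * c1"
      using t by (intro mult_left_mono c1) auto
    finally show ?thesis
      using c0(1) pos[OF t] by (simp add: ennreal_mult mult_ac)
  qed
  moreover have "ennreal c0 * c1 < top"
    using c1 by (simp add: ennreal_mult_less_top)
  ultimately show thesis using that by blast
qed

text \<open>The norm beyond \<open>t\<close> splits into the norm beyond \<open>u\<close> and the norm between \<open>t\<close> and \<open>u\<close>. The latter is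
at most a multiple of \<open>(u / t) powr (\<sigma> / 2) * a u\<close>, and \<open>a u\<close> is again controlled by the norm beyond \<open>u\<close>.\<close>

lemma N_after_growth:
  obtains c where "0 < c" "c < top" "\<And>t u. \<lbrakk>0 < t; u \<in> after \<sigma> t\<rbrakk> \<Longrightarrow>
    N (after \<sigma> t) (\<lambda>_. 1) \<le> c * ennreal ((u / t) powr (\<sigma> / 2)) * N (after \<sigma> u) (\<lambda>_. 1)"
proof -
  obtain c1 where c1: "0 < c1" "c1 < top"
    "\<And>t. 0 < t \<Longrightarrow> ennreal (a t) \<le> c1 * N (after \<sigma> t) (\<lambda>_. 1)"
    by (rule weight_le_N_after) blast
  obtain c2 where c2: "c2 < top" "\<And>t. 0 < t \<Longrightarrow>
    N (after (- \<sigma>) t) (\<lambda>u. ennreal ((u / t) powr (\<sigma> / 2))) \<le> c2 * ennreal (a t)"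
    by (rule N_before_power_le) blast
  obtain C where C: "0 < C" "C < top"
    "\<And>I J J' t h. \<lbrakk>I \<in> sets lebesgue; J \<in> sets lebesgue; J' \<in> sets lebesgue; I \<subseteq> {0<..};
        J \<subseteq> {0<..}; J' \<subseteq> {0<..}; I \<subseteq> insert t (J \<union> J'); h \<in> borel_measurable lebesgue\<rbrakk>
       \<Longrightarrow> N I h \<le> C * (N J h + N J' h)"
    by (rule N_Un) blast
  have "N (after \<sigma> t) (\<lambda>_. 1)
      \<le> C * (c2 * c1 + 1) * ennreal ((u / t) powr (\<sigma> / 2)) * N (after \<sigma> u) (\<lambda>_. 1)"
    if t: "0 < t" and u: "u \<in> after \<sigma> t" for t u
  proof -
    let ?g = "ennreal ((u / t) powr (\<sigma> / 2))" and ?B = "after \<sigma> t \<inter> after (- \<sigma>) u"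
    let ?h = "\<lambda>w. ennreal ((w / u) powr (\<sigma> / 2))"
    have u0: "0 < u" using u by (simp add: after_def)
    have mono: "1 \<le> (w / t) powr (\<sigma> / 2)" if "w \<in> after \<sigma> t" for w
      using that t orientation
      by (auto simp: after_def ge_one_powr_ge_zero powr_minus one_le_inverse_iff intro!: powr_le1)
    have "(\<lambda>w. ennreal ((w / u) powr (\<sigma> / 2))) \<in> borel_measurable borel" by measurable
    then have m: "?h \<in> borel_measurable lebesgue"
      by (simp add: measurable_completion)
    \<comment> \<open>Between \<open>t\<close> and \<open>u\<close> the constant \<open>1\<close> is dominated by \<open>(w / t) powr (\<sigma> / 2)\<close>, a power that is centred at \<open>u\<close> after
taking out the factor \<open>?g\<close>.\<close>
    have "N ?B (\<lambda>_. 1) \<le> N (after (- \<sigma>) u) (\<lambda>w. ?g * ?h w)"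
    proof (rule N_mono)
      fix w assume w: "w \<in> ?B"
      have "(u / t) powr (\<sigma> / 2) * (w / u) powr (\<sigma> / 2) = (w / t) powr (\<sigma> / 2)"
        using w t u0 by (simp add: after_def flip: powr_mult)
      then show "1 \<le> ?g * ?h w"
        using mono[of w] w by (simp flip: ennreal_mult)
    qed (use m in auto)
    also have "\<dots> = ?g * N (after (- \<sigma>) u) ?h"
      using m by (intro N_cmult) auto
    also have "\<dots> \<le> ?g * (c2 * (c1 * N (after \<sigma> u) (\<lambda>_. 1)))"
      by (intro mult_left_mono order_trans[OF c2(2)] c1(3) u0) auto
    finally have 1: "N ?B (\<lambda>_. 1) \<le> ?g * (c2 * (c1 * N (after \<sigma> u) (\<lambda>_. 1)))" .
    have "1 * N (after \<sigma> u) (\<lambda>_. 1) \<le> ?g * N (after \<sigma> u) (\<lambda>_. 1)"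
      using mono[OF u] by (intro mult_right_mono) auto
    then have 2: "N (after \<sigma> u) (\<lambda>_. 1) \<le> ?g * N (after \<sigma> u) (\<lambda>_. 1)" by simp
    have "N (after \<sigma> t) (\<lambda>_. 1) \<le> C * (N ?B (\<lambda>_. 1) + N (after \<sigma> u) (\<lambda>_. 1))"
      using u orientation by (intro C(3)[where t = u]) (auto simp: after_def)
    also have "\<dots> \<le> C * (?g * (c2 * (c1 * N (after \<sigma> u) (\<lambda>_. 1))) + ?g * N (after \<sigma> u) (\<lambda>_. 1))"
      using 1 2 by (intro mult_left_mono add_mono) auto
    also have "\<dots> = C * (c2 * c1 + 1) * ?g * N (after \<sigma> u) (\<lambda>_. 1)"
      by (simp add: algebra_simps)
    finally show ?thesis .
  qed
  moreover have "0 < c2 * c1 + 1" "c2 * c1 + 1 < top"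
    using c1 c2 by (auto simp: ennreal_mult_less_top add_nonneg_pos)
  then have "0 < C * (c2 * c1 + 1)" "C * (c2 * c1 + 1) < top"
    using C(1,2) by (auto simp: ennreal_mult_less_top ennreal_zero_less_mult_iff)
  ultimately show thesis using that by blast
qed

end

section \<open>Iterated norms\<close>

text \<open>The inner norms are taken beyond a moving point \<open>s\<close>, so the outer weight is needed on the half-line
before a point; this is why it is oriented by \<open>- \<sigma>\<close>.\<close>

locale iterated_weights =
  inner: sv_weight \<sigma> q a + outer: sv_weight "- \<sigma>" r b
  for \<sigma> :: real and q a r b +
  assumes outer_finite: "outer.N (after (- \<sigma>) 1) (\<lambda>_. 1) < top"
    and tail_finite: "outer.N (after \<sigma> 1) (\<lambda>s. inner.N (after \<sigma> s) (\<lambda>_. 1)) < top"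
begin

text \<open>Up to constants this is \<open>total\<close> of the indicator of the half-line beyond \<open>t\<close>: an outer point beyond \<open>t\<close>
sees the half-line beyond itself, an outer point before \<open>t\<close> sees all of it.\<close>

definition chi :: "real \<Rightarrow> ennreal" where
  "chi t = outer.N (after \<sigma> t) (\<lambda>s. inner.N (after \<sigma> s) (\<lambda>_. 1))
    + outer.N (after (- \<sigma>) t) (\<lambda>_. 1) * inner.N (after \<sigma> t) (\<lambda>_. 1)"

definition total :: "(real \<Rightarrow> ennreal) \<Rightarrow> ennreal" where
  "total k = outer.N {0<..} (\<lambda>s. inner.N (after \<sigma> s) k)"

definition core :: "real \<Rightarrow> (real \<Rightarrow> ennreal) \<Rightarrow> ennreal" where
  "core t k = outer.N (after (- \<sigma>) t) (\<lambda>s. inner.N (after \<sigma> s \<inter> after (- \<sigma>) t) k)"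

lemma tail_antimono:
  assumes "k \<in> borel_measurable lebesgue" "\<sigma> * s \<le> \<sigma> * s'" "J \<in> sets lebesgue"
  shows "inner.N (after \<sigma> s' \<inter> J) k \<le> inner.N (after \<sigma> s \<inter> J) k"
  using assms after_mono[OF assms(2)] by (intro inner.N_mono) auto

lemma tail_measurable:
  assumes "k \<in> borel_measurable lebesgue" "J \<in> sets lebesgue"
  shows "(\<lambda>s. inner.N (after \<sigma> s \<inter> J) k) \<in> borel_measurable lebesgue"
  by (rule oriented_antimono_measurable[OF inner.orientation tail_antimono[OF assms(1) _ assms(2)]])

lemma tail_antimono':
  assumes "k \<in> borel_measurable lebesgue" "\<sigma> * s \<le> \<sigma> * s'"
  shows "inner.N (after \<sigma> s') k \<le> inner.N (after \<sigma> s) k"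
  using tail_antimono[OF assms, of UNIV] by simp

lemma tail_measurable' [simp]:
  "k \<in> borel_measurable lebesgue \<Longrightarrow> (\<lambda>s. inner.N (after \<sigma> s) k) \<in> borel_measurable lebesgue"
  using tail_measurable[of k UNIV] by simp

text \<open>A finite outer norm forces the inner norm to be finite at some point, and local boundedness of the
weight carries finiteness from there to every point.\<close>

lemma inner_N_after_finite:
  assumes t: "0 < t"
  shows "inner.N (after \<sigma> t) (\<lambda>_. 1) < top"
proof -
  define M where "M = outer.N (after \<sigma> 1) (\<lambda>s. inner.N (after \<sigma> s) (\<lambda>_. 1))"
  define x where "x = outer.N (after \<sigma> 1) (\<lambda>_. 1)"
  interpret o: sv_weight \<sigma> r b
    using inner.orientation outer.exponent_pos outer.slowly_varying by unfold_locales
  have x: "0 < x" unfolding x_def by (rule o.N_after_pos) simp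
  have M: "M < top" using tail_finite by (simp add: M_def)
  have "\<exists>s\<in>after \<sigma> 1. inner.N (after \<sigma> s) (\<lambda>_. 1) < top"
  proof (rule ccontr)
    assume "\<not> ?thesis"
    then have inf: "inner.N (after \<sigma> s) (\<lambda>_. 1) = top" if "s \<in> after \<sigma> 1" for s
      using that by (auto simp: less_top[symmetric])
    have le: "c * x \<le> M" if "c < top" for c
    proof -
      have "c * x = outer.N (after \<sigma> 1) (\<lambda>_. c)"
        using that unfolding x_def by (subst outer.N_const[of _ c]) auto
      also have "\<dots> \<le> M"
        unfolding M_def using inf by (intro outer.N_mono) auto
      finally show ?thesis .
    qed
    have "x < top" using le[of 1] M by simp
    \<comment> \<open>A constant whose outer norm would exceed \<open>M\<close>.\<close>
    then have "(M + 1) / x < top" "(M + 1) / x * x = M + 1"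
      using x M by (auto simp: ennreal_divide_times ennreal_divide_eq_top_iff less_top[symmetric]
          ennreal_times_divide[symmetric] ennreal_divide_self top_unique)
    then have "M + 1 \<le> M" using le by metis
    then show False using M by (cases M) (auto simp flip: ennreal_1 ennreal_plus)
  qed
  then obtain s where s: "s \<in> after \<sigma> 1" "inner.N (after \<sigma> s) (\<lambda>_. 1) < top" by blast
  obtain C where C: "0 < C" "C < top"
    "\<And>I J J' t h. \<lbrakk>I \<in> sets lebesgue; J \<in> sets lebesgue; J' \<in> sets lebesgue; I \<subseteq> {0<..};
        J \<subseteq> {0<..}; J' \<subseteq> {0<..}; I \<subseteq> insert t (J \<union> J'); h \<in> borel_measurable lebesgue\<rbrakk>
       \<Longrightarrow> inner.N I h \<le> C * (inner.N J h + inner.N J' h)"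
    by (rule inner.N_Un) blast
  have "inner.N (after \<sigma> t) (\<lambda>_. 1)
      \<le> C * (inner.N (after \<sigma> t \<inter> after (- \<sigma>) s) (\<lambda>_. 1) + inner.N (after \<sigma> s) (\<lambda>_. 1))"
    by (intro C(3)[where t = s] after_split inner.orientation outer.orientation) auto
  also have "\<dots> < top"
    using C(2) s inner.N_between_finite[OF t, of s] by (auto simp: ennreal_mult_less_top after_def)
  finally show ?thesis .
qed

lemma outer_N_before_finite:
  assumes t: "0 < t"
  shows "outer.N (after (- \<sigma>) t) (\<lambda>_. 1) < top"
proof -
  obtain C where C: "0 < C" "C < top"
    "\<And>I J J' t h. \<lbrakk>I \<in> sets lebesgue; J \<in> sets lebesgue; J' \<in> sets lebesgue; I \<subseteq> {0<..};
        J \<subseteq> {0<..}; J' \<subseteq> {0<..}; I \<subseteq> insert t (J \<union> J'); h \<in> borel_measurable lebesgue\<rbrakk>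
       \<Longrightarrow> outer.N I h \<le> C * (outer.N J h + outer.N J' h)"
    by (rule outer.N_Un) blast
  have "outer.N (after (- \<sigma>) t) (\<lambda>_. 1)
      \<le> C * (outer.N (after (- \<sigma>) t \<inter> after (- (- \<sigma>)) 1) (\<lambda>_. 1) + outer.N (after (- \<sigma>) 1) (\<lambda>_. 1))"
    by (intro C(3)[where t = 1] after_split inner.orientation outer.orientation) auto
  also have "\<dots> < top"
    using C(2) outer_finite outer.N_between_finite[OF t, of 1] by (simp add: ennreal_mult_less_top)
  finally show ?thesis .
qed

lemma chi_finite:
  assumes t: "0 < t"
  shows "chi t < top"
proof -
  let ?D = "\<lambda>s. inner.N (after \<sigma> s) (\<lambda>_. 1)" and ?J = "after \<sigma> t \<inter> after (- \<sigma>) 1"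
  obtain C where C: "0 < C" "C < top"
    "\<And>I J J' t h. \<lbrakk>I \<in> sets lebesgue; J \<in> sets lebesgue; J' \<in> sets lebesgue; I \<subseteq> {0<..};
        J \<subseteq> {0<..}; J' \<subseteq> {0<..}; I \<subseteq> insert t (J \<union> J'); h \<in> borel_measurable lebesgue\<rbrakk>
       \<Longrightarrow> outer.N I h \<le> C * (outer.N J h + outer.N J' h)"
    by (rule outer.N_Un) blast
  have "outer.N ?J ?D \<le> outer.N ?J (\<lambda>_. ?D t)"
    by (intro outer.N_mono) (auto intro!: tail_antimono' dest: afterD)
  also have "\<dots> = ?D t * outer.N ?J (\<lambda>_. 1)"
    using inner_N_after_finite[OF t] after_positive[of \<sigma> t] by (intro outer.N_const) auto
  also have "\<dots> < top"
    using inner_N_after_finite[OF t] outer.N_between_finite[OF _ t, of 1]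
    by (simp add: ennreal_mult_less_top Int_commute)
  finally have J: "outer.N ?J ?D < top" .
  have "outer.N (after \<sigma> t) ?D \<le> C * (outer.N ?J ?D + outer.N (after \<sigma> 1) ?D)"
    by (intro C(3)[where t = 1] after_split inner.orientation outer.orientation) auto
  also have "\<dots> < top"
    using C(2) J tail_finite by (simp add: ennreal_mult_less_top)
  finally show ?thesis
    using inner_N_after_finite[OF t] outer_N_before_finite[OF t]
    by (simp add: chi_def ennreal_mult_less_top)
qed

lemma chi_pos: "0 < t \<Longrightarrow> 0 < chi t"
  using inner.N_after_pos[of t] outer.N_after_pos[of t]
  by (simp add: chi_def add_nonneg_pos ennreal_zero_less_mult_iff)

text \<open>The outer norm before \<open>t\<close> only grows when \<open>t\<close> moves forward, so the possible decay of \<open>chi\<close> is that of the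
inner norm beyond \<open>t\<close>.\<close>

lemma chi_growth:
  obtains c where "0 < c" "c < top"
    "\<And>t u. \<lbrakk>0 < t; u \<in> after \<sigma> t\<rbrakk> \<Longrightarrow> chi t \<le> c * ennreal ((u / t) powr (\<sigma> / 2)) * chi u"
proof -
  let ?D = "\<lambda>s. inner.N (after \<sigma> s) (\<lambda>_. 1)" and ?B = "\<lambda>t. outer.N (after (- \<sigma>) t) (\<lambda>_. 1)"
  obtain c where c: "0 < c" "c < top"
    "\<And>t u. \<lbrakk>0 < t; u \<in> after \<sigma> t\<rbrakk> \<Longrightarrow> ?D t \<le> c * ennreal ((u / t) powr (\<sigma> / 2)) * ?D u"
    by (rule inner.N_after_growth) blast
  obtain C where C: "0 < C" "C < top"
    "\<And>I J J' t h. \<lbrakk>I \<in> sets lebesgue; J \<in> sets lebesgue; J' \<in> sets lebesgue; I \<subseteq> {0<..};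
        J \<subseteq> {0<..}; J' \<subseteq> {0<..}; I \<subseteq> insert t (J \<union> J'); h \<in> borel_measurable lebesgue\<rbrakk>
       \<Longrightarrow> outer.N I h \<le> C * (outer.N J h + outer.N J' h)"
    by (rule outer.N_Un) blast
  define K where "K = C * (c + 1) + c"
  have "chi t \<le> K * ennreal ((u / t) powr (\<sigma> / 2)) * chi u"
    if t: "0 < t" and u: "u \<in> after \<sigma> t" for t u
  proof -
    let ?g = "ennreal ((u / t) powr (\<sigma> / 2))" and ?J = "after \<sigma> t \<inter> after (- \<sigma>) u"
    have u0: "0 < u" using u by (simp add: after_def)
    have "1 \<le> (u / t) powr (\<sigma> / 2)"
      using u t inner.orientation
      by (auto simp: after_def ge_one_powr_ge_zero powr_minus one_le_inverse_iff intro!: powr_le1)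
    then have g1: "1 \<le> ?g" by simp
    have BD: "?B u * ?D u \<le> chi u" and A: "outer.N (after \<sigma> u) ?D \<le> chi u"
      by (simp_all add: chi_def)
    have B: "?B t \<le> ?B u"
      using u by (intro outer.N_mono after_mono) (auto simp: after_def)
    have "outer.N ?J ?D \<le> outer.N ?J (\<lambda>_. ?D t)"
      by (intro outer.N_mono) (auto intro!: tail_antimono' dest: afterD)
    also have "\<dots> = ?D t * outer.N ?J (\<lambda>_. 1)"
      using inner_N_after_finite[OF t] after_positive[of \<sigma> t] by (intro outer.N_const) auto
    also have "\<dots> \<le> (c * ?g * ?D u) * ?B u"
      using c(3)[OF t u] by (intro mult_mono outer.N_mono) auto
    also have "\<dots> \<le> c * ?g * chi u"
      using mult_left_mono[OF BD, of "c * ?g"] by (simp add: mult_ac)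
    finally have J: "outer.N ?J ?D \<le> c * ?g * chi u" .
    have "outer.N (after \<sigma> t) ?D \<le> C * (outer.N ?J ?D + outer.N (after \<sigma> u) ?D)"
      by (intro C(3)[where t = u] after_split inner.orientation outer.orientation) auto
    also have "\<dots> \<le> C * (c * ?g * chi u + ?g * chi u)"
      using J A mult_right_mono[OF g1, of "chi u"] by (intro mult_left_mono add_mono) auto
    finally have 1: "outer.N (after \<sigma> t) ?D \<le> C * (c * ?g * chi u + ?g * chi u)" .
    have "?B t * ?D t \<le> ?B u * (c * ?g * ?D u)"
      using B c(3)[OF t u] by (intro mult_mono) auto
    also have "\<dots> \<le> c * ?g * chi u"
      using mult_left_mono[OF BD, of "c * ?g"] by (simp add: mult_ac)
    finally have "chi t \<le> C * (c * ?g * chi u + ?g * chi u) + c * ?g * chi u"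
      using 1 by (subst chi_def) (rule add_mono)
    also have "\<dots> = K * ?g * chi u"
      by (simp add: K_def algebra_simps)
    finally show ?thesis .
  qed
  moreover have "0 < K" "K < top"
    using C(1,2) c(1,2) by (auto simp: K_def ennreal_mult_less_top add_nonneg_pos)
  ultimately show thesis using that by blast
qed

text \<open>By monotonicity \<open>k\<close> is at least \<open>k t\<close> beyond \<open>t\<close>. Restricting the outer norm to the points beyond \<open>t\<close>
and to those before \<open>t\<close> bounds the two summands of \<open>chi t * k t\<close> separately, whence the factor \<open>2\<close>.\<close>

lemma chi_mult_le_total:
  assumes k: "k \<in> borel_measurable lebesgue" and t: "0 < t" and fin: "k t < top"
    and mono: "\<And>u v. \<lbrakk>0 < u; 0 < v; \<sigma> * u \<le> \<sigma> * v\<rbrakk> \<Longrightarrow> k u \<le> k v"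
  shows "chi t * k t \<le> 2 * total k"
proof -
  let ?D = "\<lambda>s. inner.N (after \<sigma> s) (\<lambda>_. 1)" and ?B = "\<lambda>t. outer.N (after (- \<sigma>) t) (\<lambda>_. 1)"
  have D: "k t * ?D s \<le> inner.N (after \<sigma> s) k" if s: "\<sigma> * t \<le> \<sigma> * s" for s
  proof -
    have "k t * ?D s = inner.N (after \<sigma> s) (\<lambda>_. k t)"
      using fin by (intro inner.N_const[symmetric]) auto
    also have "\<dots> \<le> inner.N (after \<sigma> s) k"
      using t s k by (intro inner.N_mono mono) (auto simp: after_def)
    finally show ?thesis .
  qed
  have "k t * outer.N (after \<sigma> t) ?D = outer.N (after \<sigma> t) (\<lambda>s. k t * ?D s)"
    using fin by (intro outer.N_cmult[symmetric]) auto
  also have "\<dots> \<le> total k"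
    unfolding total_def using k by (intro outer.N_mono D) (auto dest: afterD intro!: borel_measurable_times_ennreal)
  finally have 1: "k t * outer.N (after \<sigma> t) ?D \<le> total k" .
  have "k t * (?B t * ?D t) = outer.N (after (- \<sigma>) t) (\<lambda>_. k t * ?D t)"
    using fin inner_N_after_finite[OF t]
    by (subst outer.N_const) (auto simp: ennreal_mult_less_top mult_ac)
  also have "\<dots> \<le> total k"
    unfolding total_def
  proof (intro outer.N_mono)
    fix s assume "s \<in> after (- \<sigma>) t"
    then have "\<sigma> * s \<le> \<sigma> * t" by (simp add: after_def)
    then show "k t * ?D t \<le> inner.N (after \<sigma> s) k"
      using D[of t] tail_antimono'[OF k] by (meson order_refl order_trans)
  qed (use k in auto)
  finally have "k t * (?B t * ?D t) \<le> total k" .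
  with 1 have "k t * outer.N (after \<sigma> t) ?D + k t * (?B t * ?D t) \<le> total k + total k"
    by (rule add_mono)
  then show ?thesis by (simp add: chi_def algebra_simps mult_2)
qed

lemma core_le_total:
  assumes "k \<in> borel_measurable lebesgue"
  shows "core t k \<le> total k"
  unfolding core_def total_def using assms after_positive
  by (intro outer.N_mono inner.N_mono tail_measurable tail_measurable') auto

lemma core_add_le:
  obtains C where "0 < C" "C < top"
    "\<And>t M k k' k''. \<lbrakk>M < top; k \<in> borel_measurable lebesgue; k' \<in> borel_measurable lebesgue;
        k'' \<in> borel_measurable lebesgue; \<And>u. u \<in> after (- \<sigma>) t \<Longrightarrow> k u \<le> M * (k' u + k'' u)\<rbrakk>
      \<Longrightarrow> core t k \<le> C * M * (core t k' + core t k'')"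
proof -
  obtain C where C: "0 < C" "C < top"
    "\<And>I g h. \<lbrakk>I \<subseteq> {0<..}; g \<in> borel_measurable lebesgue; h \<in> borel_measurable lebesgue\<rbrakk>
       \<Longrightarrow> inner.N I (\<lambda>u. g u + h u) \<le> C * (inner.N I g + inner.N I h)"
    by (rule inner.N_add) blast
  obtain C' where C': "0 < C'" "C' < top"
    "\<And>I g h. \<lbrakk>I \<subseteq> {0<..}; g \<in> borel_measurable lebesgue; h \<in> borel_measurable lebesgue\<rbrakk>
       \<Longrightarrow> outer.N I (\<lambda>u. g u + h u) \<le> C' * (outer.N I g + outer.N I h)"
    by (rule outer.N_add) blast
  have "core t k \<le> (C' * C) * M * (core t k' + core t k'')"
    if M: "M < top" and k: "k \<in> borel_measurable lebesgue" "k' \<in> borel_measurable lebesgue"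
        "k'' \<in> borel_measurable lebesgue"
      and le: "\<And>u. u \<in> after (- \<sigma>) t \<Longrightarrow> k u \<le> M * (k' u + k'' u)" for t M k k' k''
  proof -
    let ?I = "\<lambda>s. after \<sigma> s \<inter> after (- \<sigma>) t"
    have I: "?I s \<in> sets lebesgue" "?I s \<subseteq> {0<..}" for s
      by simp_all
    have "inner.N (?I s) k \<le> M * C * (inner.N (?I s) k' + inner.N (?I s) k'')" for s
    proof -
      have "inner.N (?I s) k \<le> inner.N (?I s) (\<lambda>u. M * (k' u + k'' u))"
        using I k le by (intro inner.N_mono) auto
      also have "\<dots> = M * inner.N (?I s) (\<lambda>u. k' u + k'' u)"
        using I k M by (intro inner.N_cmult) auto
      also have "\<dots> \<le> M * (C * (inner.N (?I s) k' + inner.N (?I s) k''))"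
        using I k by (intro mult_left_mono C(3)) auto
      finally show ?thesis by (simp add: mult_ac)
    qed
    then have "core t k \<le> outer.N (after (- \<sigma>) t)
        (\<lambda>s. M * C * (inner.N (?I s) k' + inner.N (?I s) k''))"
      unfolding core_def using k by (intro outer.N_mono) (auto intro!: tail_measurable borel_measurable_times_ennreal borel_measurable_add)
    also have "\<dots> = M * C * outer.N (after (- \<sigma>) t) (\<lambda>s. inner.N (?I s) k' + inner.N (?I s) k'')"
      using k M C(2) by (intro outer.N_cmult) (auto intro!: tail_measurable borel_measurable_add simp: ennreal_mult_less_top)
    also have "\<dots> \<le> M * C * (C' * (core t k' + core t k''))"
      unfolding core_def using k by (intro mult_left_mono C'(3)) (auto intro!: tail_measurable)
    finally show ?thesis by (simp add: mult_ac)
  qed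
  moreover have "0 < C' * C" "C' * C < top"
    using C C' by (auto simp: ennreal_mult_less_top ennreal_zero_less_mult_iff)
  ultimately show thesis using that by blast
qed

text \<open>The inner norm of the power before \<open>t\<close> is at most a multiple of \<open>a t\<close>, hence of the norm of \<open>1\<close>
beyond \<open>t\<close>. This bound is independent of the outer variable, and the outer norm before \<open>t\<close> then
reproduces the second summand of \<open>chi t\<close>.\<close>

lemma core_le_chi:
  obtains C where "0 < C" "C < top"
    "\<And>t k \<kappa>. \<lbrakk>0 < t; \<kappa> < top; k \<in> borel_measurable lebesgue;
       \<And>u. u \<in> after (- \<sigma>) t \<Longrightarrow> k u \<le> \<kappa> * ennreal ((u / t) powr (\<sigma> / 2))\<rbrakk>
      \<Longrightarrow> core t k \<le> C * \<kappa> * chi t"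
proof -
  let ?D = "\<lambda>s. inner.N (after \<sigma> s) (\<lambda>_. 1)" and ?B = "\<lambda>t. outer.N (after (- \<sigma>) t) (\<lambda>_. 1)"
  obtain c1 where c1: "0 < c1" "c1 < top" "\<And>t. 0 < t \<Longrightarrow> ennreal (a t) \<le> c1 * ?D t"
    by (rule inner.weight_le_N_after) blast
  obtain c2 where c2: "c2 < top" "\<And>t. 0 < t \<Longrightarrow>
    inner.N (after (- \<sigma>) t) (\<lambda>u. ennreal ((u / t) powr (\<sigma> / 2))) \<le> c2 * ennreal (a t)"
    by (rule inner.N_before_power_le) blast
  define C where "C = (c2 + 1) * c1"
  have "core t k \<le> C * \<kappa> * chi t"
    if t: "0 < t" and \<kappa>: "\<kappa> < top" and k: "k \<in> borel_measurable lebesgue"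
      and le: "\<And>u. u \<in> after (- \<sigma>) t \<Longrightarrow> k u \<le> \<kappa> * ennreal ((u / t) powr (\<sigma> / 2))"
    for t k \<kappa>
  proof -
    have "(\<lambda>u. ennreal ((u / t) powr (\<sigma> / 2))) \<in> borel_measurable borel" by measurable
    then have m: "(\<lambda>u. ennreal ((u / t) powr (\<sigma> / 2))) \<in> borel_measurable lebesgue"
      by (simp add: measurable_completion)
    have s: "inner.N (after \<sigma> s \<inter> after (- \<sigma>) t) k \<le> \<kappa> * C * ?D t" for s
    proof -
      have "inner.N (after \<sigma> s \<inter> after (- \<sigma>) t) k
          \<le> inner.N (after (- \<sigma>) t) (\<lambda>u. \<kappa> * ennreal ((u / t) powr (\<sigma> / 2)))"
        using k m le by (intro inner.N_mono) auto
      also have "\<dots> = \<kappa> * inner.N (after (- \<sigma>) t) (\<lambda>u. ennreal ((u / t) powr (\<sigma> / 2)))"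
        using m \<kappa> by (intro inner.N_cmult) auto
      also have "\<dots> \<le> \<kappa> * (c2 * (c1 * ?D t))"
        by (intro mult_left_mono order_trans[OF c2(2)] c1(3) t) auto
      also have "\<dots> \<le> \<kappa> * ((c2 + 1) * (c1 * ?D t))"
        by (intro mult_left_mono mult_right_mono) auto
      finally show ?thesis by (simp add: C_def mult_ac)
    qed
    have fin: "\<kappa> * C * ?D t < top"
      using c1 c2 \<kappa> inner_N_after_finite[OF t] by (simp add: C_def ennreal_mult_less_top)
    have "core t k \<le> outer.N (after (- \<sigma>) t) (\<lambda>_. \<kappa> * C * ?D t)"
      unfolding core_def using s k by (intro outer.N_mono tail_measurable) auto
    also have "\<dots> = \<kappa> * C * ?D t * ?B t"
      using fin by (intro outer.N_const) auto
    also have "\<dots> = C * \<kappa> * (?B t * ?D t)"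
      by (simp add: mult_ac)
    also have "\<dots> \<le> C * \<kappa> * chi t"
      by (intro mult_left_mono) (simp_all add: chi_def)
    finally show ?thesis .
  qed
  moreover have "0 < C" "C < top"
    using c1(1,2) c2(1) by (auto simp: C_def ennreal_mult_less_top ennreal_zero_less_mult_iff add_nonneg_pos)
  ultimately show thesis using that by blast
qed

text \<open>Outer points beyond \<open>t\<close> see only the bound \<open>\<kappa>\<close> and produce the first summand of \<open>chi t\<close>. For outer
points before \<open>t\<close> the inner norm is split at \<open>t\<close>: the part before \<open>t\<close> gives the core, the part beyond \<open>t\<close>
the second summand of \<open>chi t\<close>.\<close>

lemma total_le_core:
  obtains C where "0 < C" "C < top"
    "\<And>t k k' M \<kappa>. \<lbrakk>0 < t; M < top; \<kappa> < top; k \<in> borel_measurable lebesgue;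
       k' \<in> borel_measurable lebesgue; \<And>u. 0 < u \<Longrightarrow> k u \<le> \<kappa>;
       \<And>u. u \<in> after (- \<sigma>) t \<Longrightarrow> k u \<le> M * k' u\<rbrakk>
      \<Longrightarrow> total k \<le> C * (M * core t k' + \<kappa> * chi t)"
proof -
  let ?D = "\<lambda>s. inner.N (after \<sigma> s) (\<lambda>_. 1)" and ?B = "\<lambda>t. outer.N (after (- \<sigma>) t) (\<lambda>_. 1)"
  obtain C1 where C1: "0 < C1" "C1 < top"
    "\<And>I J J' t h. \<lbrakk>I \<in> sets lebesgue; J \<in> sets lebesgue; J' \<in> sets lebesgue; I \<subseteq> {0<..};
        J \<subseteq> {0<..}; J' \<subseteq> {0<..}; I \<subseteq> insert t (J \<union> J'); h \<in> borel_measurable lebesgue\<rbrakk>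
       \<Longrightarrow> inner.N I h \<le> C1 * (inner.N J h + inner.N J' h)"
    by (rule inner.N_Un) blast
  obtain C2 where C2: "0 < C2" "C2 < top"
    "\<And>I J J' t h. \<lbrakk>I \<in> sets lebesgue; J \<in> sets lebesgue; J' \<in> sets lebesgue; I \<subseteq> {0<..};
        J \<subseteq> {0<..}; J' \<subseteq> {0<..}; I \<subseteq> insert t (J \<union> J'); h \<in> borel_measurable lebesgue\<rbrakk>
       \<Longrightarrow> outer.N I h \<le> C2 * (outer.N J h + outer.N J' h)"
    by (rule outer.N_Un) blast
  obtain C3 where C3: "0 < C3" "C3 < top"
    "\<And>I g h. \<lbrakk>I \<subseteq> {0<..}; g \<in> borel_measurable lebesgue; h \<in> borel_measurable lebesgue\<rbrakk>
       \<Longrightarrow> outer.N I (\<lambda>u. g u + h u) \<le> C3 * (outer.N I g + outer.N I h)"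
    by (rule outer.N_add) blast
  define C where "C = C2 * (C1 * C3 + 1)"
  have "total k \<le> C * (M * core t k' + \<kappa> * chi t)"
    if t: "0 < t" and fin: "M < top" "\<kappa> < top"
      and k: "k \<in> borel_measurable lebesgue" "k' \<in> borel_measurable lebesgue"
      and le\<kappa>: "\<And>u. 0 < u \<Longrightarrow> k u \<le> \<kappa>" and leM: "\<And>u. u \<in> after (- \<sigma>) t \<Longrightarrow> k u \<le> M * k' u"
    for t k k' M \<kappa>
  proof -
    let ?I = "\<lambda>s. after \<sigma> s \<inter> after (- \<sigma>) t"
    have I: "?I s \<in> sets lebesgue" "?I s \<subseteq> {0<..}" for s
      by simp_all
    have tail: "inner.N (after \<sigma> s) k \<le> \<kappa> * ?D s" for s
    proof -
      have "inner.N (after \<sigma> s) k \<le> inner.N (after \<sigma> s) (\<lambda>_. \<kappa>)"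
        using k le\<kappa> by (intro inner.N_mono) (auto simp: after_def)
      then show ?thesis using inner.N_const[of "after \<sigma> s" \<kappa>] fin by simp
    qed
    have s: "inner.N (after \<sigma> s) k \<le> C1 * (M * inner.N (?I s) k' + \<kappa> * ?D t)"
      if "s \<in> after (- \<sigma>) t" for s
    proof -
      have "inner.N (after \<sigma> s) k \<le> C1 * (inner.N (?I s) k + inner.N (after \<sigma> t) k)"
        using k by (intro C1(3)[where t = t] after_split inner.orientation) auto
      moreover have "inner.N (?I s) k \<le> inner.N (?I s) (\<lambda>u. M * k' u)"
        using I k leM by (intro inner.N_mono) auto
      moreover have "\<dots> = M * inner.N (?I s) k'"
        using I k fin by (intro inner.N_cmult) auto
      ultimately show ?thesis
        using tail[of t] by (auto elim!: order_trans intro!: mult_left_mono add_mono)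
    qed
    have fin': "\<kappa> * ?D t < top"
      using fin inner_N_after_finite[OF t] by (simp add: ennreal_mult_less_top)
    have "outer.N (after (- \<sigma>) t) (\<lambda>s. inner.N (after \<sigma> s) k)
      \<le> outer.N (after (- \<sigma>) t) (\<lambda>s. C1 * (M * inner.N (?I s) k' + \<kappa> * ?D t))"
      using k s by (intro outer.N_mono)
        (auto intro!: tail_measurable borel_measurable_times_ennreal borel_measurable_add)
    also have "\<dots> = C1 * outer.N (after (- \<sigma>) t) (\<lambda>s. M * inner.N (?I s) k' + \<kappa> * ?D t)"
      using k C1(2) by (intro outer.N_cmult)
        (auto intro!: tail_measurable borel_measurable_times_ennreal borel_measurable_add)
    also have "\<dots> \<le> C1 * (C3 * (outer.N (after (- \<sigma>) t) (\<lambda>s. M * inner.N (?I s) k')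
        + outer.N (after (- \<sigma>) t) (\<lambda>s. \<kappa> * ?D t)))"
      using k by (intro mult_left_mono C3(3)) (auto intro!: tail_measurable borel_measurable_times_ennreal)
    also have "outer.N (after (- \<sigma>) t) (\<lambda>s. M * inner.N (?I s) k') = M * core t k'"
      unfolding core_def using k fin by (intro outer.N_cmult) (auto intro!: tail_measurable)
    also have "outer.N (after (- \<sigma>) t) (\<lambda>s. \<kappa> * ?D t) = \<kappa> * ?D t * ?B t"
      using fin' by (intro outer.N_const) auto
    also have "C1 * (C3 * (M * core t k' + \<kappa> * ?D t * ?B t)) \<le> C1 * (C3 * (M * core t k' + \<kappa> * chi t))"
      by (intro mult_left_mono add_left_mono) (simp_all add: chi_def distrib_left mult_ac)
    finally have 1: "outer.N (after (- \<sigma>) t) (\<lambda>s. inner.N (after \<sigma> s) k)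
        \<le> C1 * C3 * (M * core t k' + \<kappa> * chi t)"
      by (simp add: mult_ac)
    have "outer.N (after \<sigma> t) (\<lambda>s. inner.N (after \<sigma> s) k) \<le> outer.N (after \<sigma> t) (\<lambda>s. \<kappa> * ?D s)"
      using k tail by (intro outer.N_mono) (auto intro!: borel_measurable_times_ennreal)
    also have "\<dots> = \<kappa> * outer.N (after \<sigma> t) ?D"
      using fin by (intro outer.N_cmult) auto
    also have "\<dots> \<le> M * core t k' + \<kappa> * chi t"
      by (intro add_increasing mult_left_mono) (simp_all add: chi_def)
    finally have 2: "outer.N (after \<sigma> t) (\<lambda>s. inner.N (after \<sigma> s) k) \<le> M * core t k' + \<kappa> * chi t" .
    have "total k \<le> C2 * (outer.N (after (- \<sigma>) t) (\<lambda>s. inner.N (after \<sigma> s) k)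
        + outer.N (after \<sigma> t) (\<lambda>s. inner.N (after \<sigma> s) k))"
      unfolding total_def using k inner.orientation
      by (intro C2(3)[where t = t] positive_split) auto
    also have "\<dots> \<le> C2 * (C1 * C3 * (M * core t k' + \<kappa> * chi t) + (M * core t k' + \<kappa> * chi t))"
      using 1 2 by (intro mult_left_mono add_mono) auto
    also have "\<dots> = C * (M * core t k' + \<kappa> * chi t)"
      by (simp add: C_def algebra_simps)
    finally show ?thesis .
  qed
  moreover have "0 < C1 * C3 + 1" "C1 * C3 + 1 < top"
    using C1(1,2) C3(1,2) by (auto simp: ennreal_mult_less_top add_nonneg_pos)
  then have "0 < C" "C < top"
    using C2(1,2) by (auto simp: C_def ennreal_mult_less_top ennreal_zero_less_mult_iff)
  ultimately show thesis using that by blast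
qed

end

section \<open>The K-functional\<close>

lemma K_fun_le:
  assumes "f0 \<in> pts X0" "f1 \<in> pts X1" "f = f0 + f1"
  shows "K_fun t f X0 X1 \<le> qnorm X0 f0 + t * qnorm X1 f1"
  unfolding K_fun_def using assms by (intro Inf_lower) auto

lemma K_fun_greatest:
  assumes "\<And>f0 f1. \<lbrakk>f0 \<in> pts X0; f1 \<in> pts X1; f = f0 + f1\<rbrakk> \<Longrightarrow> c \<le> qnorm X0 f0 + t * qnorm X1 f1"
  shows "c \<le> K_fun t f X0 X1"
  unfolding K_fun_def using assms by (intro Inf_greatest) auto

lemma K_fun_mono: "s \<le> t \<Longrightarrow> K_fun s f X0 X1 \<le> K_fun t f X0 X1"
  by (intro K_fun_greatest order_trans[OF K_fun_le]) (auto intro!: add_left_mono mult_right_mono)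

text \<open>Every single term \<open>\<parallel>f0\<parallel> + t * \<parallel>f1\<parallel>\<close> of the infimum, divided by \<open>t\<close>, decreases in \<open>t\<close>.\<close>

lemma K_fun_scale:
  assumes "0 < u" "u \<le> v"
  shows "ennreal (u / v) * K_fun (ennreal v) f X0 X1 \<le> K_fun (ennreal u) f X0 X1"
proof (rule K_fun_greatest)
  fix f0 f1 assume f: "f0 \<in> pts X0" "f1 \<in> pts X1" "f = f0 + f1"
  have "ennreal (u / v) * K_fun (ennreal v) f X0 X1
      \<le> ennreal (u / v) * (qnorm X0 f0 + ennreal v * qnorm X1 f1)"
    using f by (intro mult_left_mono K_fun_le) auto
  also have "\<dots> = ennreal (u / v) * qnorm X0 f0 + ennreal (u / v * v) * qnorm X1 f1"
    using assms by (subst ennreal_mult) (auto simp: distrib_left mult_ac)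
  also have "\<dots> \<le> 1 * qnorm X0 f0 + ennreal u * qnorm X1 f1"
    using assms by (intro add_mono mult_right_mono) auto
  finally show "ennreal (u / v) * K_fun (ennreal v) f X0 X1 \<le> qnorm X0 f0 + ennreal u * qnorm X1 f1"
    by simp
qed

lemma quasi_normed_zero: 
  assumes "quasi_normed X"
  shows "0 \<in> pts X" "qnorm X 0 = 0"
  using assms subspace_0 by (auto simp: quasi_normed_def)

lemma qnorm_minus:
  assumes "quasi_normed X" "x \<in> pts X"
  shows "- x \<in> pts X" "qnorm X (- x) = qnorm X x"
proof -
  show "- x \<in> pts X" using assms by (simp add: quasi_normed_def subspace_neg)
  have "qnorm X (-1 *\<^sub>R x) = ennreal \<bar>-1\<bar> * qnorm X x"
    using assms unfolding quasi_normed_def by blast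
  then show "qnorm X (- x) = qnorm X x" by simp
qed

text \<open>The two infima are pulled out one after the other by moving the other summand to the left-hand side,
where the value \<open>top\<close> has to be treated separately.\<close>

lemma ennreal_le_add_INF:
  fixes z c :: ennreal and x :: "'i \<Rightarrow> ennreal" and y :: "'j \<Rightarrow> ennreal"
  assumes le: "\<And>i j. \<lbrakk>i \<in> I; j \<in> J\<rbrakk> \<Longrightarrow> z \<le> c * (x i + y j)"
    and c: "0 < c" "c < top"
  shows "z \<le> c * (Inf (x ` I) + Inf (y ` J))"
proof -
  have le': "z / c \<le> x i + y j" if "i \<in> I" "j \<in> J" for i j
  proof -
    have "z / c \<le> c * (x i + y j) / c" using le[OF that] by (rule divide_right_mono_ennreal)
    then show ?thesis using c by (simp add: mult_divide_eq_ennreal mult.commute[of c])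
  qed
  have le2: "z / c \<le> x i + Inf (y ` J)" if i: "i \<in> I" for i
  proof (cases "x i = top")
    case False
    have "z / c - x i \<le> Inf (y ` J)"
      using le' i False by (intro INF_greatest) (simp add: ennreal_minus_le_iff)
    then show ?thesis using False by (simp add: ennreal_minus_le_iff)
  qed simp
  define b where "b = Inf (y ` J)"
  have "z / c \<le> Inf (x ` I) + b"
  proof (cases "b = top")
    case False
    have "z / c - b \<le> Inf (x ` I)"
      using le2 False unfolding b_def[symmetric]
      by (intro INF_greatest) (simp add: ennreal_minus_le_iff add.commute)
    then show ?thesis using False by (simp add: ennreal_minus_le_iff add.commute)
  qed simp
  then have "z / c \<le> Inf (x ` I) + Inf (y ` J)" by (simp only: b_def)
  then have "c * (z / c) \<le> c * (Inf (x ` I) + Inf (y ` J))" by (rule mult_left_mono) simp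
  moreover have "c * (z / c) = z"
    using c by (simp add: ennreal_times_divide mult_divide_eq_ennreal mult.commute[of c])
  ultimately show ?thesis by simp
qed

lemma K_fun_add_le:
  assumes "quasi_normed X0" "quasi_normed X1"
  obtains C where "1 \<le> C" "C < top"
    "\<And>t f g. K_fun t (f + g) X0 X1 \<le> C * (K_fun t f X0 X1 + K_fun t g X0 X1)"
proof -
  obtain C0 where C0: "1 \<le> C0" "\<forall>x\<in>pts X0. \<forall>y\<in>pts X0. qnorm X0 (x + y) \<le> ennreal C0 * (qnorm X0 x + qnorm X0 y)"
    using assms(1) unfolding quasi_normed_def by (elim conjE exE) (rule that)
  obtain C1 where C1: "1 \<le> C1" "\<forall>x\<in>pts X1. \<forall>y\<in>pts X1. qnorm X1 (x + y) \<le> ennreal C1 * (qnorm X1 x + qnorm X1 y)"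
    using assms(2) unfolding quasi_normed_def by (elim conjE exE) (rule that)
  define C where "C = ennreal (max C0 C1)"
  have C: "1 \<le> C" "C < top" "ennreal C0 \<le> C" "ennreal C1 \<le> C"
    using C0(1) by (auto simp: C_def intro!: ennreal_leI)
  have "K_fun t (f + g) X0 X1 \<le> C * (K_fun t f X0 X1 + K_fun t g X0 X1)" for t f g
  proof -
    let ?D = "\<lambda>f. {(f0, f1). f0 \<in> pts X0 \<and> f1 \<in> pts X1 \<and> f = f0 + f1}"
    let ?n = "\<lambda>(f0, f1). qnorm X0 f0 + t * qnorm X1 f1"
    have K: "K_fun t f X0 X1 = Inf (?n ` ?D f)" for f
      unfolding K_fun_def by (rule arg_cong[where f = Inf]) auto
    have "K_fun t (f + g) X0 X1 \<le> C * (Inf (?n ` ?D f) + Inf (?n ` ?D g))"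
    proof (rule ennreal_le_add_INF)
      fix i j assume i: "i \<in> ?D f" and j: "j \<in> ?D g"
      obtain f0 f1 where f: "i = (f0, f1)" "f0 \<in> pts X0" "f1 \<in> pts X1" "f = f0 + f1" using i by auto
      obtain g0 g1 where g: "j = (g0, g1)" "g0 \<in> pts X0" "g1 \<in> pts X1" "g = g0 + g1" using j by auto
      have "K_fun t (f + g) X0 X1 \<le> qnorm X0 (f0 + g0) + t * qnorm X1 (f1 + g1)"
        using f g assms by (intro K_fun_le) (auto simp: quasi_normed_def subspace_add)
      also have "\<dots> \<le> ennreal C0 * (qnorm X0 f0 + qnorm X0 g0) + t * (ennreal C1 * (qnorm X1 f1 + qnorm X1 g1))"
        using f g C0(2) C1(2) by (intro add_mono mult_left_mono) auto
      also have "\<dots> \<le> C * (qnorm X0 f0 + qnorm X0 g0) + t * (C * (qnorm X1 f1 + qnorm X1 g1))"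
        using C by (intro add_mono mult_left_mono mult_right_mono) auto
      also have "\<dots> = C * (?n i + ?n j)"
        using f g by (simp add: algebra_simps)
      finally show "K_fun t (f + g) X0 X1 \<le> C * (?n i + ?n j)" .
    qed (use C(2) less_le_trans[OF zero_less_one C(1)] in auto)
    then show ?thesis by (simp only: K)
  qed
  then show thesis by (rule that[OF C(1,2)])
qed

text \<open>If the infimum vanishes, \<open>f\<close> is a sum of elements of arbitrarily small norm, so it lies in every
neighbourhood of \<open>0\<close> of the common Hausdorff space.\<close>

lemma K_fun_eq_zero:
  assumes comp: "compatible_couple A0 A1" and t: "0 < t" and K: "K_fun (ennreal t) f A0 A1 = 0"
  shows "f = 0"
proof (rule ccontr)
  assume f: "f \<noteq> 0"
  obtain T where T: "Hausdorff_tvs T" "continuously_embedded A0 T" "continuously_embedded A1 T"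
    using comp by (auto simp: compatible_couple_def)
  have top: "topspace T = UNIV" using T by (simp add: Hausdorff_tvs_def)
  obtain U V where U: "openin T U" "openin T V" "0 \<in> U" "f \<in> V" "disjnt U V"
    using T(1) f unfolding Hausdorff_tvs_def Hausdorff_space_def by (metis UNIV_I)
  have cont: "continuous_map (prod_topology T T) T (\<lambda>(x, y). x + y)"
    using T by (simp add: Hausdorff_tvs_def)
  have "openin (prod_topology T T) {p \<in> topspace (prod_topology T T). (\<lambda>(x, y). x + y) p \<in> U}"
    using cont U(1) by (rule openin_continuous_map_preimage)
  note op = this
  obtain W0 W1 where W: "openin T W0" "openin T W1" "0 \<in> W0" "0 \<in> W1"
      "W0 \<times> W1 \<subseteq> {p \<in> topspace (prod_topology T T). (\<lambda>(x, y). x + y) p \<in> U}"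
  proof -
    have "(0, 0) \<in> {p \<in> topspace (prod_topology T T). (\<lambda>(x, y). x + y) p \<in> U}"
      using U(3) top by simp
    with that show thesis
      using op unfolding openin_prod_topology_alt by meson
  qed
  obtain e0 where e0: "0 < e0" "\<forall>x\<in>pts A0. qnorm A0 x < e0 \<longrightarrow> x \<in> W0"
    using T(2) W unfolding continuously_embedded_def by blast
  obtain e1 where e1: "0 < e1" "\<forall>x\<in>pts A1. qnorm A1 x < e1 \<longrightarrow> x \<in> W1"
    using T(3) W unfolding continuously_embedded_def by blast
  have "K_fun (ennreal t) f A0 A1 < min e0 (ennreal t * e1)"
    using K e0 e1 t by (simp add: ennreal_zero_less_mult_iff)
  then obtain f0 f1 where f01: "f0 \<in> pts A0" "f1 \<in> pts A1" "f = f0 + f1"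
      "qnorm A0 f0 + ennreal t * qnorm A1 f1 < min e0 (ennreal t * e1)"
    unfolding K_fun_def Inf_less_iff by blast
  have "qnorm A0 f0 < e0"
    using f01(4) by (auto elim!: le_less_trans[rotated])
  moreover have "ennreal t * qnorm A1 f1 < ennreal t * e1"
    using f01(4) by (auto elim!: le_less_trans[rotated])
  then have "qnorm A1 f1 < e1"
    by (metis leD leI mult_left_mono zero_le)
  ultimately have "f0 \<in> W0" "f1 \<in> W1" using e0 e1 f01 by auto
  then have "f \<in> U" using W(5) f01(3) by auto
  then show False using U by (auto simp: disjnt_def)
qed

lemma ennreal_inverse_cancel:
  fixes x :: ennreal
  assumes "0 < x" "x < top"
  shows "inverse x * x = 1"
  using assms by (metis divide_ennreal_def ennreal_divide_self less_top mult.commute not_gr_zero)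

locale couple =
  fixes A0 A1 :: "('v::real_vector) qspace"
  assumes compatible: "compatible_couple A0 A1"
begin

abbreviation K :: "'v \<Rightarrow> real \<Rightarrow> ennreal" where
  "K f u \<equiv> K_fun (ennreal u) f A0 A1"

text \<open>The representative of \<open>f\<close> for the reversed order.\<close>

definition slope :: "'v \<Rightarrow> real \<Rightarrow> ennreal" where
  "slope f u = K f u / ennreal u"

lemma quasi_normed: "quasi_normed A0" "quasi_normed A1"
  using compatible by (auto simp: compatible_couple_def quasi_Banach_def)

lemma K_measurable [simp, measurable]: "K f \<in> borel_measurable lebesgue"
  by (rule oriented_mono_measurable[of 1]) (auto intro!: K_fun_mono ennreal_leI)

lemma slope_measurable [simp, measurable]: "slope f \<in> borel_measurable lebesgue"
proof -
  have [measurable]: "(\<lambda>u::real. ennreal u) \<in> borel_measurable lebesgue"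
    by (intro measurable_completion) simp
  show ?thesis unfolding slope_def by measurable
qed

lemma K_eq_slope: "0 < u \<Longrightarrow> K f u = ennreal u * slope f u"
  by (simp add: slope_def ennreal_times_divide mult_divide_eq_ennreal mult.commute[of "ennreal u"])

lemma slope_mono:
  assumes "0 < u" "u \<le> v"
  shows "slope f v \<le> slope f u"
proof -
  have "slope f v = ennreal (u / v) * K f v / ennreal u"
    using assms by (simp add: slope_def divide_ennreal_def inverse_ennreal mult_ac ennreal_mult
        flip: ennreal_mult mult.assoc)
      (simp add: field_simps mult_ac)
  also have "\<dots> \<le> slope f u"
    unfolding slope_def using assms by (intro divide_right_mono_ennreal K_fun_scale)
  finally show ?thesis .
qed

lemma K_finite:
  assumes "f \<in> sum_pts A0 A1"
  shows "K f u < top"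
proof -
  obtain f0 f1 where f: "f0 \<in> pts A0" "f1 \<in> pts A1" "f = f0 + f1"
    using assms by (auto simp: sum_pts_def)
  then have "K f u \<le> qnorm A0 f0 + ennreal u * qnorm A1 f1" by (rule K_fun_le)
  also have "\<dots> < top" using f quasi_normed by (auto simp: quasi_normed_def ennreal_mult_less_top)
  finally show ?thesis .
qed

lemma slope_finite: "\<lbrakk>f \<in> sum_pts A0 A1; 0 < u\<rbrakk> \<Longrightarrow> slope f u < top"
  using K_finite[of f u]
  by (simp add: slope_def divide_ennreal_def inverse_ennreal ennreal_mult_less_top)

lemma K_left_le:
  assumes "f \<in> pts A0"
  shows "K f u \<le> qnorm A0 f"
  using K_fun_le[OF assms, of 0 A1 f "ennreal u"] quasi_normed_zero[OF quasi_normed(2)]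
  by simp

lemma K_right_le:
  assumes "f \<in> pts A1"
  shows "K f u \<le> ennreal u * qnorm A1 f"
  using K_fun_le[OF _ assms, of 0 A0 f "ennreal u"] quasi_normed_zero[OF quasi_normed(1)]
  by simp

lemma K_add_le:
  obtains C where "1 \<le> C" "C < top" "\<And>f g u. K (f + g) u \<le> C * (K f u + K g u)"
  by (rule K_fun_add_le[OF quasi_normed], rule that)

lemma slope_add_le:
  assumes "\<And>f g u. K (f + g) u \<le> C * (K f u + K g u)"
  shows "slope (f + g) u \<le> C * (slope f u + slope g u)"
proof -
  have "slope (f + g) u \<le> C * (K f u + K g u) / ennreal u"
    unfolding slope_def by (rule divide_right_mono_ennreal[OF assms])
  also have "\<dots> = C * (slope f u + slope g u)"
    by (simp only: slope_def divide_ennreal_def distrib_right mult.assoc)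
  finally show ?thesis .
qed

text \<open>The bounds by \<open>K f t\<close> and \<open>slope f t\<close> are those of the norms of the two pieces. For the bounds by \<open>f\<close> itself
write each piece as \<open>f\<close> minus the other one: for \<open>u \<le> t\<close> the piece \<open>f1\<close> is harmless because
\<open>slope f t \<le> slope f u\<close>, and for \<open>t \<le> u\<close> the piece \<open>f0\<close> is harmless because \<open>K f t \<le> K f u\<close>.\<close>

lemma near_optimal_decomposition:
  obtains M where "M < top"
    "\<And>f t. \<lbrakk>f \<in> sum_pts A0 A1; 0 < t\<rbrakk> \<Longrightarrow> \<exists>f0\<in>pts A0. \<exists>f1\<in>pts A1. f = f0 + f1 \<and>
       (\<forall>u. K f0 u \<le> 2 * K f t) \<and> (\<forall>u. 0 < u \<longrightarrow> u \<le> t \<longrightarrow> K f0 u \<le> M * K f u) \<and>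
       (\<forall>u. 0 < u \<longrightarrow> slope f1 u \<le> 2 * slope f t) \<and> (\<forall>u. t \<le> u \<longrightarrow> slope f1 u \<le> M * slope f u)"
proof -
  obtain C where C: "1 \<le> C" "C < top" "\<And>f g u. K (f + g) u \<le> C * (K f u + K g u)"
    by (rule K_add_le, rule that)
  have "\<exists>f0\<in>pts A0. \<exists>f1\<in>pts A1. f = f0 + f1 \<and>
      (\<forall>u. K f0 u \<le> 2 * K f t) \<and> (\<forall>u. 0 < u \<longrightarrow> u \<le> t \<longrightarrow> K f0 u \<le> C * 3 * K f u) \<and>
      (\<forall>u. 0 < u \<longrightarrow> slope f1 u \<le> 2 * slope f t) \<and> (\<forall>u. t \<le> u \<longrightarrow> slope f1 u \<le> C * 3 * slope f u)"
    if f: "f \<in> sum_pts A0 A1" and t: "0 < t" for f t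
  proof -
    have "\<exists>f0\<in>pts A0. \<exists>f1\<in>pts A1. f = f0 + f1 \<and> qnorm A0 f0 + ennreal t * qnorm A1 f1 \<le> 2 * K f t"
    \<comment> \<open>A factor 2 of slack needs a positive infimum; a vanishing one means that f is 0.\<close>
    proof (cases "K f t = 0")
      case True
      then have "f = 0" using K_fun_eq_zero[OF compatible t] by blast
      then show ?thesis
        using quasi_normed_zero[OF quasi_normed(1)] quasi_normed_zero[OF quasi_normed(2)]
        by (intro bexI[of _ 0]) auto
    next
      case False
      define c where "c = 2 * K f t"
      have "K f t < c"
        using False K_finite[OF f, of t] ennreal_add_left_cancel_less[of "K f t" 0 "K f t"]
        by (simp add: c_def mult_2 less_top zero_less_iff_neq_zero)
      then obtain f0 f1 where "f0 \<in> pts A0" "f1 \<in> pts A1" "f = f0 + f1"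
          "qnorm A0 f0 + ennreal t * qnorm A1 f1 < c"
        unfolding K_fun_def Inf_less_iff by blast
      then show ?thesis unfolding c_def[symmetric] using less_imp_le by blast
    qed
    then obtain f0 f1 where f01: "f0 \<in> pts A0" "f1 \<in> pts A1" "f = f0 + f1"
      and n: "qnorm A0 f0 + ennreal t * qnorm A1 f1 \<le> 2 * K f t" by blast
    have n0: "qnorm A0 f0 \<le> 2 * K f t"
      using n by (rule order_trans[rotated]) simp
    have n1': "ennreal t * qnorm A1 f1 \<le> 2 * K f t"
      using n by (rule order_trans[rotated]) simp
    have n1: "qnorm A1 f1 \<le> 2 * slope f t"
    proof -
      have "qnorm A1 f1 = ennreal t * qnorm A1 f1 / ennreal t"
        using t by (simp add: mult_divide_eq_ennreal mult.commute[of "ennreal t"])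
      also have "\<dots> \<le> 2 * K f t / ennreal t"
        using n1' by (rule divide_right_mono_ennreal)
      finally show ?thesis by (simp add: slope_def ennreal_times_divide)
    qed
    have three: "x + 2 * x = 3 * x" for x :: ennreal
      using distrib_right[of 1 2 x] by simp
    have K1: "K (- f1) u \<le> ennreal u * (2 * slope f t)" for u
      using K_right_le[of "- f1" u] qnorm_minus[OF quasi_normed(2) f01(2)] n1
      by (auto elim!: order_trans intro!: mult_left_mono)
    have K0: "K (- f0) u \<le> 2 * K f t" for u
      using K_left_le[of "- f0" u] qnorm_minus[OF quasi_normed(1) f01(1)] n0
      by (auto elim!: order_trans)
    have a: "K f0 u \<le> 2 * K f t" for u
      using K_left_le[OF f01(1)] n0 by (rule order_trans)
    have b: "K f0 u \<le> C * 3 * K f u" if u: "0 < u" "u \<le> t" for u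
    proof -
      have "K f0 u = K (f + - f1) u" using f01 by simp
      also have "\<dots> \<le> C * (K f u + K (- f1) u)" by (rule C)
      also have "\<dots> \<le> C * (K f u + ennreal u * (2 * slope f u))"
        using slope_mono[OF u, of f]
        by (intro mult_left_mono add_left_mono order_trans[OF K1]) auto
      also have "\<dots> = C * 3 * K f u"
        using K_eq_slope[OF u(1), of f] three[of "K f u"] by (simp add: mult_ac)
      finally show ?thesis .
    qed
    have c: "slope f1 u \<le> 2 * slope f t" if u: "0 < u" for u
    proof -
      have "slope f1 u \<le> ennreal u * qnorm A1 f1 / ennreal u"
        unfolding slope_def by (intro divide_right_mono_ennreal K_right_le f01)
      also have "\<dots> = qnorm A1 f1"
        using u by (simp add: mult_divide_eq_ennreal mult.commute[of "ennreal u"])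
      finally show ?thesis using n1 by (rule order_trans)
    qed
    have d: "slope f1 u \<le> C * 3 * slope f u" if u: "t \<le> u" for u
    proof -
      have "K f1 u = K (f + - f0) u" using f01 by simp
      also have "\<dots> \<le> C * (K f u + K (- f0) u)" by (rule C)
      also have "\<dots> \<le> C * (K f u + 2 * K f u)"
        using u by (intro mult_left_mono add_left_mono order_trans[OF K0] K_fun_mono) (auto intro: ennreal_leI)
      also have "\<dots> = C * 3 * K f u"
        by (simp add: three mult.assoc)
      finally have "slope f1 u \<le> C * 3 * K f u / ennreal u"
        unfolding slope_def by (rule divide_right_mono_ennreal)
      then show ?thesis by (simp add: slope_def ennreal_times_divide)
    qed
    show ?thesis using f01 a b c d by blast
  qed
  moreover have "C * 3 < top" using C by (simp add: ennreal_mult_less_top)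
  ultimately show thesis using that by blast
qed

end

section \<open>The crossed estimates\<close>

locale holmstedt =
  couple A0 A1 + R: iterated_weights 1 q0 a0 r0 b0 + L: iterated_weights "- 1" q1 a1 r1 b1
  for A0 A1 :: "('v::real_vector) qspace" and q0 a0 r0 b0 q1 a1 r1 b1
begin

definition \<rho> :: "real \<Rightarrow> ennreal" where
  "\<rho> t = ennreal t * (R.chi t / L.chi t)"

text \<open>The balance between the two spaces at the level \<open>t\<close>; it converts an estimate in one norm into one in the
other.\<close>

lemma \<rho>_mult: "0 < t \<Longrightarrow> \<rho> t * L.chi t = ennreal t * R.chi t"
  using ennreal_inverse_cancel[OF L.chi_pos[of t] L.chi_finite]
  by (simp add: \<rho>_def divide_ennreal_def mult.assoc)

lemma \<rho>_pos: "0 < t \<Longrightarrow> 0 < \<rho> t"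
  using \<rho>_mult[of t] R.chi_pos[of t] by (auto simp: zero_less_iff_neq_zero)

text \<open>Here \<open>slope h u\<close> is at most a multiple of the norm of \<open>h\<close> divided by \<open>L.chi u\<close>, and \<open>L.chi\<close> cannot be much smaller at
\<open>u < t\<close> than at \<open>t\<close>. So \<open>K h u\<close> is dominated on the left of \<open>t\<close> by a multiple of \<open>(u / t) powr (1 / 2)\<close>.\<close>

lemma cross_estimate_left:
  obtains C where "0 < C" "C < top"
    "\<And>h t. \<lbrakk>h \<in> sum_pts A0 A1; L.total (slope h) < top; 0 < t\<rbrakk>
      \<Longrightarrow> R.core t (K h) \<le> C * (\<rho> t * L.total (slope h))"
proof -
  obtain c where c: "0 < c" "c < top"
    "\<And>t u. \<lbrakk>0 < t; u \<in> after (- 1) t\<rbrakk> \<Longrightarrow> L.chi t \<le> c * ennreal ((u / t) powr (- 1 / 2)) * L.chi u"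
    by (rule L.chi_growth) blast
  obtain C where C: "0 < C" "C < top"
    "\<And>t k \<kappa>. \<lbrakk>0 < t; \<kappa> < top; k \<in> borel_measurable lebesgue;
       \<And>u. u \<in> after (- 1) t \<Longrightarrow> k u \<le> \<kappa> * ennreal ((u / t) powr (1 / 2))\<rbrakk>
      \<Longrightarrow> R.core t k \<le> C * \<kappa> * R.chi t"
    by (rule R.core_le_chi) blast
  have "R.core t (K h) \<le> (C * c * 2) * (\<rho> t * L.total (slope h))"
    if h: "h \<in> sum_pts A0 A1" and fin: "L.total (slope h) < top" and t: "0 < t" for h t
  proof -
    let ?H = "L.total (slope h)"
    define \<kappa> where "\<kappa> = inverse (L.chi t) * (c * 2 * ?H * ennreal t)"
    have "inverse (L.chi t) < top"
      using L.chi_pos[OF t] by (simp add: ennreal_inverse_eq_top_iff less_top[symmetric])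
    then have \<kappa>: "\<kappa> < top"
      using c(2) fin by (simp add: \<kappa>_def ennreal_mult_less_top)
    have "K h u \<le> \<kappa> * ennreal ((u / t) powr (1 / 2))" if u: "u \<in> after (- 1) t" for u
    proof -
      have u0: "0 < u" using u by (rule afterD)
      have "(u / t) powr (1 / 2) = u / t * (u / t) powr (- 1 / 2)"
        using u0 t powr_mult_base[of "u / t" "- 1 / 2"] by simp
      then have pow: "u * (u / t) powr (- 1 / 2) = t * (u / t) powr (1 / 2)"
        using t by simp
      have "L.chi t * K h u = ennreal u * (L.chi t * slope h u)"
        using u0 by (simp add: K_eq_slope mult_ac)
      also have "\<dots> \<le> ennreal u * (c * ennreal ((u / t) powr (- 1 / 2)) * L.chi u * slope h u)"
        using c(3)[OF t u] by (intro mult_left_mono mult_right_mono) auto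
      also have "\<dots> = ennreal u * c * ennreal ((u / t) powr (- 1 / 2)) * (L.chi u * slope h u)"
        by (simp add: mult_ac)
      also have "\<dots> \<le> ennreal u * c * ennreal ((u / t) powr (- 1 / 2)) * (2 * ?H)"
        using u0 h by (intro mult_left_mono L.chi_mult_le_total slope_mono slope_finite) auto
      also have "\<dots> = c * 2 * ?H * ennreal (u * (u / t) powr (- 1 / 2))"
        using u0 by (subst ennreal_mult) (auto simp: mult_ac)
      also have "\<dots> = c * 2 * ?H * ennreal t * ennreal ((u / t) powr (1 / 2))"
        using t by (subst pow, subst ennreal_mult) (auto simp: mult_ac)
      finally have "inverse (L.chi t) * (L.chi t * K h u)
          \<le> inverse (L.chi t) * (c * 2 * ?H * ennreal t * ennreal ((u / t) powr (1 / 2)))"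
        by (rule mult_left_mono) simp
      then show ?thesis
        using ennreal_inverse_cancel[OF L.chi_pos L.chi_finite, OF t t]
        by (simp add: \<kappa>_def mult.assoc[symmetric])
    qed
    then have "R.core t (K h) \<le> C * \<kappa> * R.chi t"
      using t \<kappa> by (intro C) auto
    also have "\<dots> = (C * c * 2) * (\<rho> t * ?H)"
      by (simp add: \<kappa>_def \<rho>_def divide_ennreal_def mult_ac)
    finally show ?thesis .
  qed
  moreover have "0 < C * c * 2" "C * c * 2 < top"
    using C(1,2) c(1,2) by (auto simp: ennreal_mult_less_top ennreal_zero_less_mult_iff)
  ultimately show thesis using that by blast
qed

text \<open>The mirror image: \<open>slope g u\<close> is dominated on the right of \<open>t\<close> by a multiple of
\<open>(u / t) powr (- 1 / 2)\<close>.\<close>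

lemma cross_estimate_right:
  obtains C where "0 < C" "C < top"
    "\<And>g t. \<lbrakk>g \<in> sum_pts A0 A1; R.total (K g) < top; 0 < t\<rbrakk>
      \<Longrightarrow> \<rho> t * L.core t (slope g) \<le> C * R.total (K g)"
proof -
  obtain c where c: "0 < c" "c < top"
    "\<And>t u. \<lbrakk>0 < t; u \<in> after 1 t\<rbrakk> \<Longrightarrow> R.chi t \<le> c * ennreal ((u / t) powr (1 / 2)) * R.chi u"
    by (rule R.chi_growth) blast
  obtain C where C: "0 < C" "C < top"
    "\<And>t k \<kappa>. \<lbrakk>0 < t; \<kappa> < top; k \<in> borel_measurable lebesgue;
       \<And>u. u \<in> after (- (- 1)) t \<Longrightarrow> k u \<le> \<kappa> * ennreal ((u / t) powr (- 1 / 2))\<rbrakk>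
      \<Longrightarrow> L.core t k \<le> C * \<kappa> * L.chi t"
    by (rule L.core_le_chi) blast
  have "\<rho> t * L.core t (slope g) \<le> (C * c * 2) * R.total (K g)"
    if g: "g \<in> sum_pts A0 A1" and fin: "R.total (K g) < top" and t: "0 < t" for g t
  proof -
    let ?G = "R.total (K g)"
    define \<kappa> where "\<kappa> = inverse (R.chi t) * (c * 2 * ?G * ennreal (1 / t))"
    have "inverse (R.chi t) < top"
      using R.chi_pos[OF t] by (simp add: ennreal_inverse_eq_top_iff less_top[symmetric])
    then have \<kappa>: "\<kappa> < top"
      using c(2) fin by (simp add: \<kappa>_def ennreal_mult_less_top)
    have "slope g u \<le> \<kappa> * ennreal ((u / t) powr (- 1 / 2))" if "u \<in> after (- (- 1)) t" for u
    proof -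
      have u: "u \<in> after 1 t" using that by simp
      have u0: "0 < u" using u by (rule afterD)
      have "(u / t) powr (1 / 2) = u / t * (u / t) powr (- 1 / 2)"
        using u0 t powr_mult_base[of "u / t" "- 1 / 2"] by simp
      then have pow: "1 / u * (u / t) powr (1 / 2) = 1 / t * (u / t) powr (- 1 / 2)"
        using u0 by simp
      have sl: "slope g u = ennreal (1 / u) * K g u"
        using u0 by (simp add: slope_def divide_ennreal_def inverse_ennreal inverse_eq_divide mult_ac)
      have "R.chi t * slope g u = ennreal (1 / u) * (R.chi t * K g u)"
        by (simp add: sl mult_ac)
      also have "\<dots> \<le> ennreal (1 / u) * (c * ennreal ((u / t) powr (1 / 2)) * R.chi u * K g u)"
        using c(3)[OF t u] by (intro mult_left_mono mult_right_mono) auto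
      also have "\<dots> = ennreal (1 / u) * c * ennreal ((u / t) powr (1 / 2)) * (R.chi u * K g u)"
        by (simp add: mult_ac)
      also have "\<dots> \<le> ennreal (1 / u) * c * ennreal ((u / t) powr (1 / 2)) * (2 * ?G)"
        using u0 g by (intro mult_left_mono R.chi_mult_le_total K_fun_mono K_finite)
          (auto intro: ennreal_leI)
      also have "\<dots> = c * 2 * ?G * ennreal (1 / u * (u / t) powr (1 / 2))"
        using u0 by (subst ennreal_mult) (auto simp: mult_ac)
      also have "\<dots> = c * 2 * ?G * ennreal (1 / t) * ennreal ((u / t) powr (- 1 / 2))"
        using t by (subst pow, subst ennreal_mult) (auto simp: mult_ac)
      finally have "inverse (R.chi t) * (R.chi t * slope g u)
          \<le> inverse (R.chi t) * (c * 2 * ?G * ennreal (1 / t) * ennreal ((u / t) powr (- 1 / 2)))"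
        by (rule mult_left_mono) simp
      then show ?thesis
        using ennreal_inverse_cancel[OF R.chi_pos R.chi_finite, OF t t]
        by (simp add: \<kappa>_def mult.assoc[symmetric])
    qed
    then have "L.core t (slope g) \<le> C * \<kappa> * L.chi t"
      using t \<kappa> by (intro C) auto
    then have "\<rho> t * L.core t (slope g) \<le> \<rho> t * (C * \<kappa> * L.chi t)"
      by (rule mult_left_mono) simp
    also have "\<dots> = C * \<kappa> * (\<rho> t * L.chi t)"
      by (simp add: mult_ac)
    also have "\<dots> = C * \<kappa> * (ennreal t * R.chi t)"
      by (simp add: \<rho>_mult t)
    also have "\<dots> = (inverse (R.chi t) * R.chi t) * (ennreal (1 / t) * ennreal t) * (C * c * 2 * ?G)"
      by (simp add: \<kappa>_def mult_ac)
    also have "ennreal (1 / t) * ennreal t = 1"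
      using t by (simp flip: ennreal_mult)
    finally show ?thesis
      using ennreal_inverse_cancel[OF R.chi_pos R.chi_finite, OF t t] by simp
  qed
  moreover have "0 < C * c * 2" "C * c * 2 < top"
    using C(1,2) c(1,2) by (auto simp: ennreal_mult_less_top ennreal_zero_less_mult_iff)
  ultimately show thesis using that by blast
qed

definition holmstedt_rhs :: "'v \<Rightarrow> real \<Rightarrow> ennreal" where
  "holmstedt_rhs f t = R.core t (K f) + \<rho> t * L.core t (slope f) + R.chi t * K f t"

lemma holmstedt_rhs_le:
  obtains C where "0 < C" "C < top"
    "\<And>g h t. \<lbrakk>g \<in> sum_pts A0 A1; h \<in> sum_pts A0 A1; R.total (K g) < top;
        L.total (slope h) < top; 0 < t\<rbrakk>
      \<Longrightarrow> holmstedt_rhs (g + h) t \<le> C * (R.total (K g) + \<rho> t * L.total (slope h))"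
proof -
  obtain Ck where Ck: "1 \<le> Ck" "Ck < top" "\<And>f g u. K (f + g) u \<le> Ck * (K f u + K g u)"
    by (rule K_add_le) blast
  obtain C0 where C0: "0 < C0" "C0 < top"
    "\<And>t M k k' k''. \<lbrakk>M < top; k \<in> borel_measurable lebesgue; k' \<in> borel_measurable lebesgue;
        k'' \<in> borel_measurable lebesgue; \<And>u. u \<in> after (- 1) t \<Longrightarrow> k u \<le> M * (k' u + k'' u)\<rbrakk>
      \<Longrightarrow> R.core t k \<le> C0 * M * (R.core t k' + R.core t k'')"
    by (rule R.core_add_le) blast
  obtain C1 where C1: "0 < C1" "C1 < top"
    "\<And>t M k k' k''. \<lbrakk>M < top; k \<in> borel_measurable lebesgue; k' \<in> borel_measurable lebesgue;
        k'' \<in> borel_measurable lebesgue; \<And>u. u \<in> after (- (- 1)) t \<Longrightarrow> k u \<le> M * (k' u + k'' u)\<rbrakk>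
      \<Longrightarrow> L.core t k \<le> C1 * M * (L.core t k' + L.core t k'')"
    by (rule L.core_add_le) blast
  obtain D0 where D0: "0 < D0" "D0 < top"
    "\<And>h t. \<lbrakk>h \<in> sum_pts A0 A1; L.total (slope h) < top; 0 < t\<rbrakk>
      \<Longrightarrow> R.core t (K h) \<le> D0 * (\<rho> t * L.total (slope h))"
    by (rule cross_estimate_left) blast
  obtain D1 where D1: "0 < D1" "D1 < top"
    "\<And>g t. \<lbrakk>g \<in> sum_pts A0 A1; R.total (K g) < top; 0 < t\<rbrakk>
      \<Longrightarrow> \<rho> t * L.core t (slope g) \<le> D1 * R.total (K g)"
    by (rule cross_estimate_right) blast
  define C where "C = C0 * Ck * (1 + D0) + C1 * Ck * (1 + D1) + Ck * 2"
  have "holmstedt_rhs (g + h) t \<le> C * (R.total (K g) + \<rho> t * L.total (slope h))"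
    if g: "g \<in> sum_pts A0 A1" "R.total (K g) < top"
      and h: "h \<in> sum_pts A0 A1" "L.total (slope h) < top" and t: "0 < t" for g h t
  proof -
    define G H where "G = R.total (K g)" and "H = \<rho> t * L.total (slope h)"
    have "R.core t (K (g + h)) \<le> C0 * Ck * (R.core t (K g) + R.core t (K h))"
      using Ck by (intro C0) auto
    also have "\<dots> \<le> C0 * Ck * (G + D0 * H)"
      unfolding G_def H_def using g h t
      by (intro mult_left_mono add_mono R.core_le_total D0) auto
    also have "\<dots> \<le> C0 * Ck * ((1 + D0) * (G + H))"
      by (intro mult_left_mono) (auto simp: algebra_simps add_increasing2 add_mono)
    finally have 1: "R.core t (K (g + h)) \<le> C0 * Ck * (1 + D0) * (G + H)"
      by (simp add: mult.assoc)
    have "\<rho> t * L.core t (slope (g + h)) \<le> \<rho> t * (C1 * Ck * (L.core t (slope g) + L.core t (slope h)))"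
      using Ck by (intro mult_left_mono C1 slope_add_le) auto
    also have "\<dots> = C1 * Ck * (\<rho> t * L.core t (slope g) + \<rho> t * L.core t (slope h))"
      by (simp add: algebra_simps)
    also have "\<dots> \<le> C1 * Ck * (D1 * G + H)"
      unfolding G_def H_def using g h t
      by (intro mult_left_mono add_mono L.core_le_total D1) auto
    also have "\<dots> \<le> C1 * Ck * ((1 + D1) * (G + H))"
      by (intro mult_left_mono) (auto simp: algebra_simps add_increasing2 add_mono)
    finally have 2: "\<rho> t * L.core t (slope (g + h)) \<le> C1 * Ck * (1 + D1) * (G + H)"
      by (simp add: mult.assoc)
    \<comment> \<open>The last term needs only the pointwise bounds at t.\<close>
    have kg: "R.chi t * K g t \<le> 2 * G"
      unfolding G_def using g t
      by (intro R.chi_mult_le_total K_finite K_fun_mono) (auto intro: ennreal_leI)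
    have "L.chi t * slope h t \<le> 2 * L.total (slope h)"
      using h t by (intro L.chi_mult_le_total slope_finite slope_mono) auto
    then have "\<rho> t * (L.chi t * slope h t) \<le> \<rho> t * (2 * L.total (slope h))"
      by (rule mult_left_mono) simp
    then have "(\<rho> t * L.chi t) * slope h t \<le> 2 * H"
      by (simp add: H_def mult_ac)
    then have kh: "R.chi t * K h t \<le> 2 * H"
      unfolding \<rho>_mult[OF t] using t by (simp add: K_eq_slope mult_ac)
    have "R.chi t * K (g + h) t \<le> R.chi t * (Ck * (K g t + K h t))"
      by (intro mult_left_mono Ck) auto
    also have "\<dots> = Ck * (R.chi t * K g t + R.chi t * K h t)"
      by (simp add: algebra_simps)
    also have "\<dots> \<le> Ck * (2 * G + 2 * H)"
      using kg kh by (intro mult_left_mono add_mono) auto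
    finally have 3: "R.chi t * K (g + h) t \<le> Ck * 2 * (G + H)"
      by (simp add: algebra_simps)
    show ?thesis
      using add_mono[OF add_mono[OF 1 2] 3]
      by (simp add: holmstedt_rhs_def C_def distrib_right flip: G_def H_def)
  qed
  moreover have "0 < Ck"
    by (rule less_le_trans[OF zero_less_one Ck(1)])
  then have "0 < C" "C < top"
    using Ck(2) C0(1,2) C1(1,2) D0(1,2) D1(1,2)
    by (auto simp: C_def ennreal_mult_less_top ennreal_zero_less_mult_iff intro!: add_nonneg_pos)
  ultimately show thesis using that by blast
qed

lemma le_holmstedt_rhs:
  obtains C where "0 < C" "C < top"
    "\<And>f t. \<lbrakk>f \<in> sum_pts A0 A1; 0 < t\<rbrakk> \<Longrightarrow> \<exists>f0\<in>pts A0. \<exists>f1\<in>pts A1. f = f0 + f1 \<and>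
       R.total (K f0) + \<rho> t * L.total (slope f1) \<le> C * holmstedt_rhs f t"
proof -
  obtain M where M: "M < top"
    "\<And>f t. \<lbrakk>f \<in> sum_pts A0 A1; 0 < t\<rbrakk> \<Longrightarrow> \<exists>f0\<in>pts A0. \<exists>f1\<in>pts A1. f = f0 + f1 \<and>
       (\<forall>u. K f0 u \<le> 2 * K f t) \<and> (\<forall>u. 0 < u \<longrightarrow> u \<le> t \<longrightarrow> K f0 u \<le> M * K f u) \<and>
       (\<forall>u. 0 < u \<longrightarrow> slope f1 u \<le> 2 * slope f t) \<and> (\<forall>u. t \<le> u \<longrightarrow> slope f1 u \<le> M * slope f u)"
    by (rule near_optimal_decomposition) blast
  obtain C0 where C0: "0 < C0" "C0 < top"
    "\<And>t k k' M \<kappa>. \<lbrakk>0 < t; M < top; \<kappa> < top; k \<in> borel_measurable lebesgue;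
       k' \<in> borel_measurable lebesgue; \<And>u. 0 < u \<Longrightarrow> k u \<le> \<kappa>;
       \<And>u. u \<in> after (- 1) t \<Longrightarrow> k u \<le> M * k' u\<rbrakk>
      \<Longrightarrow> R.total k \<le> C0 * (M * R.core t k' + \<kappa> * R.chi t)"
    by (rule R.total_le_core) blast
  obtain C1 where C1: "0 < C1" "C1 < top"
    "\<And>t k k' M \<kappa>. \<lbrakk>0 < t; M < top; \<kappa> < top; k \<in> borel_measurable lebesgue;
       k' \<in> borel_measurable lebesgue; \<And>u. 0 < u \<Longrightarrow> k u \<le> \<kappa>;
       \<And>u. u \<in> after (- (- 1)) t \<Longrightarrow> k u \<le> M * k' u\<rbrakk>
      \<Longrightarrow> L.total k \<le> C1 * (M * L.core t k' + \<kappa> * L.chi t)"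
    by (rule L.total_le_core) blast
  define C where "C = (C0 + C1) * (M + 2)"
  have "\<exists>f0\<in>pts A0. \<exists>f1\<in>pts A1. f = f0 + f1 \<and>
      R.total (K f0) + \<rho> t * L.total (slope f1) \<le> C * holmstedt_rhs f t"
    if f: "f \<in> sum_pts A0 A1" and t: "0 < t" for f t
  proof -
    obtain f0 f1 where f01: "f0 \<in> pts A0" "f1 \<in> pts A1" "f = f0 + f1"
      and f0: "\<forall>u. K f0 u \<le> 2 * K f t" "\<forall>u. 0 < u \<longrightarrow> u \<le> t \<longrightarrow> K f0 u \<le> M * K f u"
      and f1: "\<forall>u. 0 < u \<longrightarrow> slope f1 u \<le> 2 * slope f t" "\<forall>u. t \<le> u \<longrightarrow> slope f1 u \<le> M * slope f u"
      using M(2)[OF f t] by blast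
    let ?E = "holmstedt_rhs f t"
    have "R.total (K f0) \<le> C0 * (M * R.core t (K f) + 2 * K f t * R.chi t)"
      using f0 t M(1) K_finite[OF f]
      by (intro C0) (auto simp: ennreal_mult_less_top after_def)
    also have "\<dots> \<le> C0 * (M * ?E + 2 * ?E)"
      by (intro mult_left_mono add_mono) (auto simp: holmstedt_rhs_def mult.assoc mult.commute[of "K f t"] add_increasing
          intro!: mult_left_mono)
    finally have 0: "R.total (K f0) \<le> C0 * (M + 2) * ?E"
      by (simp add: distrib_right mult.assoc)
    have "L.total (slope f1) \<le> C1 * (M * L.core t (slope f) + 2 * slope f t * L.chi t)"
      using f1 t M(1) slope_finite[OF f t]
      by (intro C1) (auto simp: ennreal_mult_less_top after_def)
    then have "\<rho> t * L.total (slope f1) \<le> \<rho> t * (C1 * (M * L.core t (slope f) + 2 * slope f t * L.chi t))"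
      by (rule mult_left_mono) simp
    also have "\<dots> = C1 * (M * (\<rho> t * L.core t (slope f)) + 2 * slope f t * (\<rho> t * L.chi t))"
      by (simp add: algebra_simps)
    also have "\<dots> = C1 * (M * (\<rho> t * L.core t (slope f)) + 2 * (R.chi t * K f t))"
      unfolding \<rho>_mult[OF t] using t by (simp add: K_eq_slope mult_ac)
    also have "\<dots> \<le> C1 * (M * ?E + 2 * ?E)"
      by (intro mult_left_mono add_mono) (auto simp: holmstedt_rhs_def add_increasing add_increasing2
          intro!: mult_left_mono)
    finally have 1: "\<rho> t * L.total (slope f1) \<le> C1 * (M + 2) * ?E"
      by (simp add: distrib_right mult.assoc)
    have "R.total (K f0) + \<rho> t * L.total (slope f1) \<le> C * ?E"
      using add_mono[OF 0 1] by (simp add: C_def distrib_right)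
    then show ?thesis using f01 by blast
  qed
  moreover have "0 < C" "C < top"
    using C0(1,2) C1(1,2) M(1)
    by (auto simp: C_def ennreal_mult_less_top ennreal_zero_less_mult_iff add_pos_nonneg add_nonneg_pos)
  ultimately show thesis using that by blast
qed

end

section \<open>The equivalence\<close>

lemma after_right: "0 \<le> t \<Longrightarrow> after 1 t = {t<..}"
  by (auto simp: after_def)

lemma after_left: "after (- 1) t = {0<..<t}"
  by (auto simp: after_def)

lemma wnorm_one:
  assumes "I \<in> sets lebesgue" "I \<subseteq> {0<..}"
  shows "wnorm 1 q a I h = wnorm 0 q a I (\<lambda>u. h u / ennreal u)"
  unfolding wnorm_def
proof (rule Lq_norm_cong[OF assms(1)])
  fix u assume "u \<in> I"
  then have u: "0 < u" using assms(2) by auto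
  have "u powr (- 1 - recip q) = inverse u * u powr (- 0 - recip q)"
    using u by (simp add: powr_diff powr_minus divide_inverse)
  then have "ennreal (u powr (- 1 - recip q) * a u)
      = ennreal (inverse u) * ennreal (u powr (- 0 - recip q) * a u)"
    using u by (simp add: mult.assoc flip: ennreal_mult')
  then show "ennreal (u powr (- 1 - recip q) * a u) * h u
      = ennreal (u powr (- 0 - recip q) * a u) * (h u / ennreal u)"
    using u by (simp add: divide_ennreal_def inverse_ennreal mult_ac)
qed

context holmstedt
begin

lemma R_norm_eq_total: "R_norm 0 r0 b0 q0 a0 A0 A1 f = R.total (K f)"
  unfolding R_norm_def R.total_def by (rule wnorm_cong) (auto simp: after_right)

lemma wnorm_one_eq_slope:
  "0 \<le> t \<Longrightarrow> wnorm 1 q1 a1 {t<..<s} (K f) = L.inner.N {t<..<s} (slope f)"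
  by (subst wnorm_one) (auto simp: slope_def[abs_def])

lemma L_norm_eq_total: "L_norm 1 r1 b1 q1 a1 A0 A1 f = L.total (slope f)"
  unfolding L_norm_def L.total_def
  by (rule wnorm_cong) (auto simp: after_left wnorm_one_eq_slope)

lemma R_core_eq:
  "R.core t (K f) = wnorm 0 r0 b0 {0<..<t} (\<lambda>s. wnorm 0 q0 a0 {s<..<t} (K f))"
proof -
  have "after 1 s \<inter> {0<..<t} = {s<..<t}" if "s \<in> {0<..<t}" for s
    using that by (auto simp: after_def)
  then show ?thesis
    unfolding R.core_def after_left by (intro wnorm_cong) auto
qed

lemma L_core_eq:
  assumes "0 < t"
  shows "L.core t (slope f) = wnorm 0 r1 b1 {t<..} (\<lambda>s. wnorm 1 q1 a1 {t<..<s} (K f))"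
proof -
  have "after (- 1) s \<inter> {t<..} = {t<..<s}" for s
    using assms by (auto simp: after_def)
  then show ?thesis
    unfolding L.core_def minus_minus after_right[OF less_imp_le[OF assms]] using assms
    by (intro wnorm_cong) (auto simp: wnorm_one_eq_slope)
qed

lemma R_chi_eq:
  assumes "0 < t"
  shows "R.chi t = wnorm 0 r0 b0 {t<..} (\<lambda>s. wnorm 0 q0 a0 {s<..} (\<lambda>u. 1))
        + wnorm 0 r0 b0 {0<..<t} (\<lambda>s. 1) * wnorm 0 q0 a0 {t<..} (\<lambda>u. 1)"
proof -
  have "wnorm 0 r0 b0 {t<..} (\<lambda>s. wnorm 0 q0 a0 (after 1 s) (\<lambda>u. 1))
      = wnorm 0 r0 b0 {t<..} (\<lambda>s. wnorm 0 q0 a0 {s<..} (\<lambda>u. 1))"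
    using assms by (intro wnorm_cong) (auto simp: after_right)
  then show ?thesis
    unfolding R.chi_def using assms by (simp add: after_right after_left)
qed

lemma L_chi_eq:
  assumes "0 < t"
  shows "L.chi t = wnorm 0 r1 b1 {0<..<t} (\<lambda>s. wnorm 0 q1 a1 {0<..<s} (\<lambda>u. 1))
        + wnorm 0 r1 b1 {t<..} (\<lambda>s. 1) * wnorm 0 q1 a1 {0<..<t} (\<lambda>u. 1)"
  unfolding L.chi_def using assms by (simp add: after_right after_left)

text \<open>If the right-hand side is infinite, the upper estimate holds trivially; otherwise its finiteness is what
puts the two near optimal pieces into the limiting spaces.\<close>

lemma K_fun_equivalence:
  fixes R L :: "'v qspace"
  defines "R \<equiv> R_space 0 r0 b0 q0 a0 A0 A1" and "L \<equiv> L_space 1 r1 b1 q1 a1 A0 A1"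
  obtains C where "0 < C" "C < top"
    "\<And>f t. \<lbrakk>f \<in> sum_pts R L; 0 < t\<rbrakk>
      \<Longrightarrow> holmstedt_rhs f t \<le> C * K_fun (\<rho> t) f R L \<and> K_fun (\<rho> t) f R L \<le> C * holmstedt_rhs f t"
proof -
  have R: "pts R = {f \<in> sum_pts A0 A1. R.total (K f) < top}" "qnorm R f = R.total (K f)" for f
    by (simp_all add: R_def R_space_def R_norm_eq_total)
  have L: "pts L = {f \<in> sum_pts A0 A1. L.total (slope f) < top}" "qnorm L f = L.total (slope f)" for f
    by (simp_all add: L_def L_space_def L_norm_eq_total)
  obtain C0 where C0: "0 < C0" "C0 < top"
    "\<And>g h t. \<lbrakk>g \<in> sum_pts A0 A1; h \<in> sum_pts A0 A1; R.total (K g) < top;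
        L.total (slope h) < top; 0 < t\<rbrakk>
      \<Longrightarrow> holmstedt_rhs (g + h) t \<le> C0 * (R.total (K g) + \<rho> t * L.total (slope h))"
    by (rule holmstedt_rhs_le) blast
  obtain C1 where C1: "0 < C1" "C1 < top"
    "\<And>f t. \<lbrakk>f \<in> sum_pts A0 A1; 0 < t\<rbrakk> \<Longrightarrow> \<exists>f0\<in>pts A0. \<exists>f1\<in>pts A1. f = f0 + f1 \<and>
       R.total (K f0) + \<rho> t * L.total (slope f1) \<le> C1 * holmstedt_rhs f t"
    by (rule le_holmstedt_rhs) blast
  have "holmstedt_rhs f t \<le> (C0 + C1) * K_fun (\<rho> t) f R L
      \<and> K_fun (\<rho> t) f R L \<le> (C0 + C1) * holmstedt_rhs f t"
    if f: "f \<in> sum_pts R L" and t: "0 < t" for f t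
  proof
    have "inverse C0 * holmstedt_rhs f t \<le> K_fun (\<rho> t) f R L"
    proof (rule K_fun_greatest)
      fix g h assume gh: "g \<in> pts R" "h \<in> pts L" "f = g + h"
      have "inverse C0 * holmstedt_rhs f t \<le> inverse C0 * (C0 * (qnorm R g + \<rho> t * qnorm L h))"
        using gh t unfolding gh(3) by (intro mult_left_mono) (auto simp: R L intro!: C0)
      then show "inverse C0 * holmstedt_rhs f t \<le> qnorm R g + \<rho> t * qnorm L h"
        by (simp add: ennreal_inverse_cancel[OF C0(1,2)] flip: mult.assoc)
    qed
    then have "C0 * (inverse C0 * holmstedt_rhs f t) \<le> C0 * K_fun (\<rho> t) f R L"
      by (rule mult_left_mono) simp
    then have "holmstedt_rhs f t \<le> C0 * K_fun (\<rho> t) f R L"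
      using ennreal_inverse_cancel[OF C0(1,2)] by (simp add: mult.commute[of C0 "inverse C0"] flip: mult.assoc)
    also have "\<dots> \<le> (C0 + C1) * K_fun (\<rho> t) f R L"
      by (intro mult_right_mono) auto
    finally show "holmstedt_rhs f t \<le> (C0 + C1) * K_fun (\<rho> t) f R L" .
    obtain g h where gh: "g \<in> sum_pts A0 A1" "h \<in> sum_pts A0 A1" "f = g + h"
      using f unfolding sum_pts_def[of R L] R L by auto
    then obtain g0 g1 h0 h1 where gh': "g0 \<in> pts A0" "h0 \<in> pts A0" "g1 \<in> pts A1" "h1 \<in> pts A1"
        "f = (g0 + h0) + (g1 + h1)"
      by (auto simp: sum_pts_def algebra_simps)
    have fA: "f \<in> sum_pts A0 A1"
      unfolding sum_pts_def using gh' quasi_normed by (auto simp: quasi_normed_def intro!: subspace_add)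
    show "K_fun (\<rho> t) f R L \<le> (C0 + C1) * holmstedt_rhs f t"
    proof (cases "holmstedt_rhs f t = top")
      case True
      then show ?thesis using C0(1) by (auto simp: ennreal_mult_top)
    next
      case False
      obtain f0 f1 where f01: "f0 \<in> pts A0" "f1 \<in> pts A1" "f = f0 + f1"
        and le: "R.total (K f0) + \<rho> t * L.total (slope f1) \<le> C1 * holmstedt_rhs f t"
        using C1(3)[OF fA t] by blast
      have "C1 * holmstedt_rhs f t < top"
        using False C1(2) by (simp add: ennreal_mult_less_top less_top)
      with le have fin: "R.total (K f0) + \<rho> t * L.total (slope f1) < top"
        by (rule le_less_trans)
      then have "R.total (K f0) < top" "L.total (slope f1) < top"
        using \<rho>_pos[OF t] by (auto simp: ennreal_mult_less_top)
      moreover have "f0 \<in> sum_pts A0 A1" "f1 \<in> sum_pts A0 A1"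
        using f01 quasi_normed_zero[OF quasi_normed(1)] quasi_normed_zero[OF quasi_normed(2)]
        unfolding sum_pts_def by force+
      ultimately have "K_fun (\<rho> t) f R L \<le> R.total (K f0) + \<rho> t * L.total (slope f1)"
        using K_fun_le[of f0 R f1 L f "\<rho> t"] f01 by (simp add: R L)
      also note le
      also have "C1 * holmstedt_rhs f t \<le> (C0 + C1) * holmstedt_rhs f t"
        by (intro mult_right_mono) auto
      finally show ?thesis .
    qed
  qed
  moreover have "0 < C0 + C1" "C0 + C1 < top"
    using C0(1,2) C1(1,2) by (auto simp: add_pos_pos)
  ultimately show thesis using that by blast
qed

end

theorem theorem35:
  fixes A0 A1 :: "('v::real_vector) qspace"
    and q0 r0 q1 r1 :: ennreal
    and a0 b0 a1 b1 :: "real \<Rightarrow> real"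
    and \<chi>0 \<chi>1 \<rho> :: "real \<Rightarrow> ennreal"
    and R L :: "'v qspace"
  assumes couple: "compatible_couple A0 A1"
    and nontrivial: "pts A0 \<inter> pts A1 \<noteq> {0}"
    and exponents1: "0 < q1" "0 < r1"
    and sv1: "slowly_varying a1" "slowly_varying b1"
    and fin1: "wnorm 0 r1 b1 {1<..} (\<lambda>s. 1) < \<infinity>"
      "wnorm 0 r1 b1 {0<..<1} (\<lambda>s. wnorm 0 q1 a1 {0<..<s} (\<lambda>u. 1)) < \<infinity>"
    and \<chi>1: "\<And>t. t > 0 \<Longrightarrow> \<chi>1 t =
        wnorm 0 r1 b1 {0<..<t} (\<lambda>s. wnorm 0 q1 a1 {0<..<s} (\<lambda>u. 1))
        + wnorm 0 r1 b1 {t<..} (\<lambda>s. 1) * wnorm 0 q1 a1 {0<..<t} (\<lambda>u. 1)"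
    and exponents0: "0 < r0" "0 < q0"
    and sv0: "slowly_varying a0" "slowly_varying b0"
    and fin0: "wnorm 0 r0 b0 {0<..<1} (\<lambda>s. 1) < \<infinity>"
      "wnorm 0 r0 b0 {1<..} (\<lambda>s. wnorm 0 q0 a0 {s<..} (\<lambda>u. 1)) < \<infinity>"
    and \<chi>0: "\<And>t. t > 0 \<Longrightarrow> \<chi>0 t =
        wnorm 0 r0 b0 {t<..} (\<lambda>s. wnorm 0 q0 a0 {s<..} (\<lambda>u. 1))
        + wnorm 0 r0 b0 {0<..<t} (\<lambda>s. 1) * wnorm 0 q0 a0 {t<..} (\<lambda>u. 1)"
    and \<rho>: "\<And>t. t > 0 \<Longrightarrow> \<rho> t = ennreal t * (\<chi>0 t / \<chi>1 t)"
    and R: "R = R_space 0 r0 b0 q0 a0 A0 A1"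
    and L: "L = L_space 1 r1 b1 q1 a1 A0 A1"
    and spaces_nontrivial: "pts R \<noteq> {0}" "pts L \<noteq> {0}"
  shows "\<exists>C::real. C > 0 \<and> (\<forall>f \<in> sum_pts R L. \<forall>t>0.
     (let rhs =
        wnorm 0 r0 b0 {0<..<t} (\<lambda>s. wnorm 0 q0 a0 {s<..<t} (\<lambda>u. K_fun (ennreal u) f A0 A1))
        + \<rho> t * wnorm 0 r1 b1 {t<..} (\<lambda>s. wnorm 1 q1 a1 {t<..<s} (\<lambda>u. K_fun (ennreal u) f A0 A1))
        + \<chi>0 t * K_fun (ennreal t) f A0 A1
      in ennreal (inverse C) * rhs \<le> K_fun (\<rho> t) f R L \<and>
         K_fun (\<rho> t) f R L \<le> ennreal C * rhs))"
proof -
  have "wnorm 0 r0 b0 {1<..} (\<lambda>s. wnorm 0 q0 a0 (after 1 s) (\<lambda>u. 1))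
      = wnorm 0 r0 b0 {1<..} (\<lambda>s. wnorm 0 q0 a0 {s<..} (\<lambda>u. 1))"
    by (intro wnorm_cong) (auto simp: after_right)
  then interpret H: holmstedt A0 A1 q0 a0 r0 b0 q1 a1 r1 b1
    using couple exponents0 exponents1 sv0 sv1 fin0 fin1
    by unfold_locales (simp_all add: after_right after_left)
  obtain C where C: "0 < C" "C < top"
    "\<And>f t. \<lbrakk>f \<in> sum_pts R L; 0 < t\<rbrakk>
      \<Longrightarrow> H.holmstedt_rhs f t \<le> C * K_fun (H.\<rho> t) f R L \<and> K_fun (H.\<rho> t) f R L \<le> C * H.holmstedt_rhs f t"
    unfolding R L by (rule H.K_fun_equivalence) blast
  define c where "c = enn2real C"
  have c: "0 < c" "C = ennreal c"
    using C(1,2) by (simp_all add: c_def enn2real_positive_iff less_top)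
  have "ennreal (inverse c) * rhs \<le> K_fun (\<rho> t) f R L \<and> K_fun (\<rho> t) f R L \<le> ennreal c * rhs"
    if f: "f \<in> sum_pts R L" and t: "0 < t" and rhs: "rhs =
        wnorm 0 r0 b0 {0<..<t} (\<lambda>s. wnorm 0 q0 a0 {s<..<t} (\<lambda>u. K_fun (ennreal u) f A0 A1))
        + \<rho> t * wnorm 0 r1 b1 {t<..} (\<lambda>s. wnorm 1 q1 a1 {t<..<s} (\<lambda>u. K_fun (ennreal u) f A0 A1))
        + \<chi>0 t * K_fun (ennreal t) f A0 A1" for f t rhs
  proof -
    have \<rho>': "\<rho> t = H.\<rho> t"
      using t by (simp add: \<rho> \<chi>0 \<chi>1 H.\<rho>_def H.R_chi_eq H.L_chi_eq)
    have E: "rhs = H.holmstedt_rhs f t"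
      using t by (simp add: rhs H.holmstedt_rhs_def \<rho>' \<chi>0 H.R_core_eq H.L_core_eq H.R_chi_eq)
    have "ennreal (inverse c) * rhs \<le> ennreal (inverse c) * (ennreal c * K_fun (\<rho> t) f R L)"
      using C(3)[OF f t] unfolding E \<rho>' c(2) by (intro mult_left_mono) auto
    also have "\<dots> = K_fun (\<rho> t) f R L"
      using c(1) by (simp flip: mult.assoc ennreal_mult)
    finally show ?thesis
      using C(3)[OF f t] unfolding E \<rho>' c(2) by blast
  qed
  then show ?thesis
    using c(1) unfolding Let_def by blast
qed

end
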